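(* Define $\lambda:\mathcal H\to\mathbf{QSym}$ on the class of a topology $\mathcal T$ on a finite set $X$ by $\lambda(\mathcal T)=\sum_{f\in\mathcal L_{\mathcal T}(Z)}\prod_{x\in X}f(x)$, where $Z$ is an infinite denumerable totally ordered alphabet of commuting variables and $\mathbf{QSym}(Z)$ is identified with $\mathbf{QSym}$; equivalently $\lambda(\mathcal T)=\sum_{(X_1,\dots,X_k)}M_{(|X_1|,\dots,|X_k|)}$, the sum over all set compositions $(X_1,\dots,X_k)$ of $X$ such that for $x\in X_i,y\in X_j$, $x<_{\mathcal T}y\Rightarrow i<j$ and $x\sim_{\mathcal T}y\Rightarrow i=j$. Then $\lambda$ is a Hopf algebra morphism from $(\mathcal H,\cdot,\Delta)$ to $(\mathbf{QSym},\cdot,\Delta)$, and it is compatible with the internal coproducts: $(\lambda\otimes\lambda)\circ\Gamma=\rho\circ\lambda$.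
   Context: For a topology $\mathcal T$ on a finite set $X$: $x\le_{\mathcal T}y$ iff every open set containing $x$ contains $y$ (open sets = final segments); $x\sim_{\mathcal T}y$ iff $x\le_{\mathcal T}y\le_{\mathcal T}x$; $x<_{\mathcal T}y$ iff $x\le_{\mathcal T}y$ and not $y\le_{\mathcal T}x$; $\mathcal T|_Y=\{W\cap Y:W\in\mathcal T\}$; $Y$ is $\mathcal T$-connected if $(Y,\mathcal T|_Y)$ is connected. $\mathcal L_{\mathcal T}(Z)$ is the set of maps $f:X\to Z$ with $x<_{\mathcal T}y\Rightarrow f(x)<f(y)$ and $x\sim_{\mathcal T}y\Rightarrow f(x)=f(y)$. $\mathcal H=\bigoplus_n\mathcal H_n$ is spanned by homeomorphism classes of topologies on $n$-element sets ($\mathcal H_0=K\mathbf 1$), with product induced by $\mathcal T_1\mathcal T_2$ on $X_1\sqcup X_2$ ($Y$ open iff $Y\cap X_i\in\mathcal T_i$), coproduct $\Delta(\mathcal T)=\sum_{Y\in\mathcal T}\mathcal T|_{X\setminus Y}\otimes\mathcal T|_Y$, and internal coproduct $\Gamma(\mathcal T)=\sum\mathcal T'\otimes\mathcal T/\mathcal T'$ over $\mathcal T$-admissible $\mathcal T'$; here $\mathcal T'\prec\mathcal T$ means every $\mathcal T$-open set is $\mathcal T'$-open, $\mathcal T/\mathcal T'$ is the topology on $X$ with quasi-order the transitive closure of $x\,\mathcal R\,y\iff(x\le_{\mathcal T}y\text{ or }y\le_{\mathcal T'}x)$, and $\mathcal T'$ is $\mathcal T$-admissible if $\mathcal T'\prec\mathcal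 T$, $\mathcal T'|_Y=\mathcal T|_Y$ for every $\mathcal T'$-connected $Y$, and $x\sim_{\mathcal T/\mathcal T'}y\iff x\sim_{\mathcal T'/\mathcal T'}y$. $\mathbf{QSym}$ has basis $M_c$ indexed by compositions $c=(c_1,\dots,c_k)$ (finite sequences of positive integers, the empty one giving the unit), realized as $M_c(Z)=\sum_{z_1<\dots<z_k}z_1^{c_1}\cdots z_k^{c_k}$. For $i_1,\dots,i_p\ge0$, $\mathrm{QSh}(i_1,\dots,i_p)$ is the set of surjections $u:[i_1+\dots+i_p]\to[\max u]$ strictly increasing on each consecutive block of sizes $i_1,\dots,i_p$. Structure: $M_{(c_1,\dots,c_k)}M_{(c_{k+1},\dots,c_{k+l})}=\sum_{\sigma\in\mathrm{QSh}(k,l)}M_{(\sum_{\sigma(i)=1}c_i,\dots,\sum_{\sigma(i)=\max\sigma}c_i)}$; $\Delta(M_{(c_1,\dots,c_k)})=\sum_{i=0}^kM_{(c_1,\dots,c_i)}\otimes M_{(c_{i+1},\dots,c_k)}$; $\rho(M_{(c_1,\dots,c_k)})=\sum_{i_1+\dots+i_p=k,\,i_j\ge1}M_{(c_1,\dots,c_{i_1})}\cdots M_{(c_{i_1+\dots+i_{p-1}+1},\dots,c_k)}\otimes M_{(C_1,\dots,C_p)}$ with $C_j=c_{i_1+\dots+i_{j-1}+1}+\dots+c_{i_1+\dots+i_j}$. *)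

theory Defs
  imports
    "HOL-Analysis.Analysis"
    "HOL-Library.Poly_Mapping"
    "HOL-Library.Multiset"
begin

section \<open>Free modules with a distinguished basis\<close>

text \<open>
  The vector space with basis \<open>'b\<close> over \<open>'k\<close> is \<open>'b \<Rightarrow>\<^sub>0 'k\<close>. The tensor product of the spaces
  with bases \<open>'b\<close> and \<open>'c\<close> is the space with basis \<open>'b \<times> 'c\<close>, the pair \<open>(b, c)\<close> standing for
  \<open>b \<otimes> c\<close>.
\<close>

definition bas :: "'b \<Rightarrow> ('b \<Rightarrow>\<^sub>0 'k::field)" where
  "bas b = Poly_Mapping.single b 1"

definition smul :: "'k::field \<Rightarrow> ('b \<Rightarrow>\<^sub>0 'k) \<Rightarrow> ('b \<Rightarrow>\<^sub>0 'k)" where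
  "smul a p = Poly_Mapping.map ((*) a) p"

definition lin_ext :: "('b \<Rightarrow> ('c \<Rightarrow>\<^sub>0 'k::field)) \<Rightarrow> ('b \<Rightarrow>\<^sub>0 'k) \<Rightarrow> ('c \<Rightarrow>\<^sub>0 'k)" where
  "lin_ext f p = (\<Sum>b\<in>Poly_Mapping.keys p. smul (Poly_Mapping.lookup p b) (f b))"

definition bilin_ext ::
    "('b \<Rightarrow> 'c \<Rightarrow> ('d \<Rightarrow>\<^sub>0 'k::field)) \<Rightarrow> ('b \<Rightarrow>\<^sub>0 'k) \<Rightarrow> ('c \<Rightarrow>\<^sub>0 'k) \<Rightarrow> ('d \<Rightarrow>\<^sub>0 'k)" where
  "bilin_ext f p q = lin_ext (\<lambda>b. lin_ext (\<lambda>c. f b c) q) p"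

definition tensor :: "('b \<Rightarrow>\<^sub>0 'k::field) \<Rightarrow> ('c \<Rightarrow>\<^sub>0 'k) \<Rightarrow> ('b \<times> 'c \<Rightarrow>\<^sub>0 'k)" where
  "tensor = bilin_ext (\<lambda>b c. bas (b, c))"

definition tensor_map ::
    "(('b \<Rightarrow>\<^sub>0 'k::field) \<Rightarrow> ('d \<Rightarrow>\<^sub>0 'k)) \<Rightarrow> (('c \<Rightarrow>\<^sub>0 'k) \<Rightarrow> ('e \<Rightarrow>\<^sub>0 'k)) \<Rightarrow>
     ('b \<times> 'c \<Rightarrow>\<^sub>0 'k) \<Rightarrow> ('d \<times> 'e \<Rightarrow>\<^sub>0 'k)" where
  "tensor_map f g = lin_ext (\<lambda>(b, c). tensor (f (bas b)) (g (bas c)))"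


section \<open>Hopf algebra morphisms\<close>

record (overloaded) ('b, 'k) bialgebra =
  mult :: "('b \<Rightarrow>\<^sub>0 'k::field) \<Rightarrow> ('b \<Rightarrow>\<^sub>0 'k) \<Rightarrow> ('b \<Rightarrow>\<^sub>0 'k)"
  unit :: "'b \<Rightarrow>\<^sub>0 'k"
  comult :: "('b \<Rightarrow>\<^sub>0 'k) \<Rightarrow> ('b \<times> 'b \<Rightarrow>\<^sub>0 'k)"
  counit :: "('b \<Rightarrow>\<^sub>0 'k) \<Rightarrow> 'k"

definition mult_tensor :: "('b, 'k::field) bialgebra \<Rightarrow> ('b \<times> 'b \<Rightarrow>\<^sub>0 'k) \<Rightarrow> ('b \<Rightarrow>\<^sub>0 'k)" where
  "mult_tensor A = lin_ext (\<lambda>(b, c). mult A (bas b) (bas c))"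

definition is_antipode :: "('b, 'k::field) bialgebra \<Rightarrow> (('b \<Rightarrow>\<^sub>0 'k) \<Rightarrow> ('b \<Rightarrow>\<^sub>0 'k)) \<Rightarrow> bool" where
  "is_antipode A S \<longleftrightarrow>
     Vector_Spaces.linear smul smul S \<and>
     (\<forall>x. mult_tensor A (tensor_map S id (comult A x)) = smul (counit A x) (unit A)) \<and>
     (\<forall>x. mult_tensor A (tensor_map id S (comult A x)) = smul (counit A x) (unit A))"

definition hopf_algebra_morphism ::
    "('b, 'k::field) bialgebra \<Rightarrow> ('c, 'k) bialgebra \<Rightarrow> (('b \<Rightarrow>\<^sub>0 'k) \<Rightarrow> ('c \<Rightarrow>\<^sub>0 'k)) \<Rightarrow> bool" where
  "hopf_algebra_morphism A B \<phi> \<longleftrightarrow>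
     Vector_Spaces.linear smul smul \<phi> \<and>
     (\<forall>x y. \<phi> (mult A x y) = mult B (\<phi> x) (\<phi> y)) \<and>
     \<phi> (unit A) = unit B \<and>
     (\<forall>x. comult B (\<phi> x) = tensor_map \<phi> \<phi> (comult A x)) \<and>
     (\<forall>x. counit B (\<phi> x) = counit A x) \<and>
     (\<forall>S S'. is_antipode A S \<longrightarrow> is_antipode B S' \<longrightarrow> (\<forall>x. \<phi> (S x) = S' (\<phi> x)))"


section \<open>Finite topologies\<close>

definition top_le :: "'a topology \<Rightarrow> 'a \<Rightarrow> 'a \<Rightarrow> bool" where
  "top_le T x y \<longleftrightarrow> x \<in> topspace T \<and> y \<in> topspace T \<and> (\<forall>U. openin T U \<longrightarrow> x \<in> U \<longrightarrow> y \<in> U)"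

definition top_sim :: "'a topology \<Rightarrow> 'a \<Rightarrow> 'a \<Rightarrow> bool" where
  "top_sim T x y \<longleftrightarrow> top_le T x y \<and> top_le T y x"

definition top_less :: "'a topology \<Rightarrow> 'a \<Rightarrow> 'a \<Rightarrow> bool" where
  "top_less T x y \<longleftrightarrow> top_le T x y \<and> \<not> top_le T y x"

definition upset_topology :: "'a set \<Rightarrow> ('a \<Rightarrow> 'a \<Rightarrow> bool) \<Rightarrow> 'a topology" where
  "upset_topology X q = topology (\<lambda>U. U \<subseteq> X \<and> (\<forall>x\<in>U. \<forall>y\<in>X. q x y \<longrightarrow> y \<in> U))"

lemma openin_upset_topology:
  "openin (upset_topology X q) U \<longleftrightarrow> U \<subseteq> X \<and> (\<forall>x\<in>U. \<forall>y\<in>X. q x y \<longrightarrow> y \<in> U)"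
proof -
  have "istopology (\<lambda>U. U \<subseteq> X \<and> (\<forall>x\<in>U. \<forall>y\<in>X. q x y \<longrightarrow> y \<in> U))"
    unfolding istopology_def by blast
  then show ?thesis
    by (simp add: upset_topology_def topology_inverse')
qed

lemma topspace_upset_topology [simp]: "topspace (upset_topology X q) = X"
  unfolding topspace_def openin_upset_topology by blast

lemma top_le_upset_topology:
  assumes "\<And>x. x \<in> X \<Longrightarrow> q x x" and "\<And>x y z. q x y \<Longrightarrow> q y z \<Longrightarrow> q x z"
  shows "top_le (upset_topology X q) x y \<longleftrightarrow> x \<in> X \<and> y \<in> X \<and> q x y"
proof
  assume le: "top_le (upset_topology X q) x y"
  then have xy: "x \<in> X" "y \<in> X" by (simp_all add: top_le_def)
  have "openin (upset_topology X q) {z \<in> X. q x z}"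
    unfolding openin_upset_topology using assms(2) by blast
  with le xy assms(1) have "y \<in> {z \<in> X. q x z}"
    unfolding top_le_def by blast
  with xy show "x \<in> X \<and> y \<in> X \<and> q x y" by blast
qed (auto simp: top_le_def openin_upset_topology)

definition finer_top :: "'a topology \<Rightarrow> 'a topology \<Rightarrow> bool" where
  "finer_top T' T \<longleftrightarrow> topspace T' = topspace T \<and> (\<forall>U. openin T U \<longrightarrow> openin T' U)"

definition quot_top :: "'a topology \<Rightarrow> 'a topology \<Rightarrow> 'a topology" where
  "quot_top T T' = upset_topology (topspace T) (tranclp (\<lambda>x y. top_le T x y \<or> top_le T' y x))"

definition admissible :: "'a topology \<Rightarrow> 'a topology \<Rightarrow> bool" where
  "admissible T T' \<longleftrightarrow>
     finer_top T' T \<and>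
     (\<forall>Y. connectedin T' Y \<longrightarrow> subtopology T' Y = subtopology T Y) \<and>
     (\<forall>x\<in>topspace T. \<forall>y\<in>topspace T.
        top_sim (quot_top T T') x y \<longleftrightarrow> top_sim (quot_top T' T') x y)"


section \<open>The Hopf algebra of finite topologies\<close>

text \<open>Every finite space is homeomorphic to one whose points are natural numbers.\<close>

quotient_type ftop_class =
  "nat topology" / partial: "\<lambda>S T. finite (topspace S) \<and> S homeomorphic_space T"
proof (rule part_equivpI)
  show "\<exists>S::nat topology. finite (topspace S) \<and> S homeomorphic_space S"
    by (rule exI[of _ "discrete_topology {}"]) auto
next
  have fin: "finite (topspace T)"
    if "finite (topspace S)" "S homeomorphic_space T" for S T :: "nat topology"
  proof -
    from that(2) obtain f where "homeomorphic_map S T f"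
      unfolding homeomorphic_space by blast
    from homeomorphic_imp_surjective_map[OF this] that(1) show ?thesis
      by (metis finite_imageI)
  qed
  show "symp (\<lambda>S T :: nat topology. finite (topspace S) \<and> S homeomorphic_space T)"
    by (rule sympI) (use fin homeomorphic_space_sym in blast)
next
  show "transp (\<lambda>S T :: nat topology. finite (topspace S) \<and> S homeomorphic_space T)"
    by (rule transpI) (use homeomorphic_space_trans in blast)
qed

definition homeo_class :: "'a topology \<Rightarrow> ftop_class" where
  "homeo_class T = abs_ftop_class (SOME S. S homeomorphic_space T)"

text \<open>
  The operations below are invariant under homeomorphism; on a class they are evaluated at the
  representative \<open>rep_ftop_class C\<close>.
\<close>

definition disj_union_top :: "'a topology \<Rightarrow> 'a topology \<Rightarrow> (bool \<times> 'a) topology" where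
  "disj_union_top T1 T2 = sum_topology (\<lambda>i. if i then T2 else T1) UNIV"

definition top_coprod :: "'a topology \<Rightarrow> (ftop_class \<times> ftop_class \<Rightarrow>\<^sub>0 'k::field)" where
  "top_coprod T = (\<Sum>Y | openin T Y.
     tensor (bas (homeo_class (subtopology T (topspace T - Y)))) (bas (homeo_class (subtopology T Y))))"

definition top_internal_coprod :: "'a topology \<Rightarrow> (ftop_class \<times> ftop_class \<Rightarrow>\<^sub>0 'k::field)" where
  "top_internal_coprod T = (\<Sum>T' | admissible T T'.
     tensor (bas (homeo_class T')) (bas (homeo_class (quot_top T T'))))"

definition empty_class :: ftop_class where
  "empty_class = homeo_class (discrete_topology ({} :: nat set))"

definition H_alg :: "(ftop_class, 'k::field) bialgebra" where
  "H_alg = \<lparr> mult = bilin_ext (\<lambda>C D. bas (homeo_class (disj_union_top (rep_ftop_class C) (rep_ftop_class D)))),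
             unit = bas empty_class,
             comult = lin_ext (\<lambda>C. top_coprod (rep_ftop_class C)),
             counit = (\<lambda>h. Poly_Mapping.lookup h empty_class) \<rparr>"

definition Gamma_H :: "(ftop_class \<Rightarrow>\<^sub>0 'k::field) \<Rightarrow> (ftop_class \<times> ftop_class \<Rightarrow>\<^sub>0 'k)" where
  "Gamma_H = lin_ext (\<lambda>C. top_internal_coprod (rep_ftop_class C))"


section \<open>Quasi-symmetric functions\<close>

typedef composition = "{c :: nat list. \<forall>i\<in>set c. 0 < i}"
  by (rule exI[of _ "[]"]) simp

definition M :: "nat list \<Rightarrow> (composition \<Rightarrow>\<^sub>0 'k::field)" where
  "M c = bas (Abs_composition c)"

text \<open>Quasi-shuffles and entries of compositions are indexed from \<open>0\<close>.\<close>

definition QSh :: "nat \<Rightarrow> nat \<Rightarrow> (nat \<Rightarrow> nat) set" where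
  "QSh k l = {u \<in> extensional {..<k + l}.
     (\<exists>m. u ` {..<k + l} = {..<m}) \<and> strict_mono_on {..<k} u \<and> strict_mono_on {k..<k + l} u}"

definition qsh_merge :: "nat list \<Rightarrow> (nat \<Rightarrow> nat) \<Rightarrow> nat list" where
  "qsh_merge w u = map (\<lambda>j. \<Sum>i | i < length w \<and> u i = j. w ! i) [0..<card (u ` {..<length w})]"

definition qsym_prod :: "nat list \<Rightarrow> nat list \<Rightarrow> (composition \<Rightarrow>\<^sub>0 'k::field)" where
  "qsym_prod c d = (\<Sum>u\<in>QSh (length c) (length d). M (qsh_merge (c @ d) u))"

definition qsym_coprod :: "nat list \<Rightarrow> (composition \<times> composition \<Rightarrow>\<^sub>0 'k::field)" where
  "qsym_coprod c = (\<Sum>i\<le>length c. tensor (M (take i c)) (M (drop i c)))"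

definition QSym_alg :: "(composition, 'k::field) bialgebra" where
  "QSym_alg = \<lparr> mult = bilin_ext (\<lambda>c d. qsym_prod (Rep_composition c) (Rep_composition d)),
                unit = M [],
                comult = lin_ext (\<lambda>c. qsym_coprod (Rep_composition c)),
                counit = (\<lambda>q. Poly_Mapping.lookup q (Abs_composition [])) \<rparr>"

text \<open>
  A decomposition \<open>i\<^sub>1 + \<dots> + i\<^sub>p = k\<close> with all \<open>i\<^sub>j \<ge> 1\<close> is encoded by the list of the
  corresponding consecutive blocks of \<open>c\<close>.
\<close>

definition qsym_internal_coprod :: "nat list \<Rightarrow> (composition \<times> composition \<Rightarrow>\<^sub>0 'k::field)" where
  "qsym_internal_coprod c = (\<Sum>bs | concat bs = c \<and> [] \<notin> set bs.
     tensor (foldr (mult QSym_alg) (map M bs) (unit QSym_alg)) (M (map sum_list bs)))"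

definition rho :: "(composition \<Rightarrow>\<^sub>0 'k::field) \<Rightarrow> (composition \<times> composition \<Rightarrow>\<^sub>0 'k)" where
  "rho = lin_ext (\<lambda>c. qsym_internal_coprod (Rep_composition c))"


section \<open>Realization on an alphabet, and the map \<open>\<lambda>\<close>\<close>

text \<open>
  Monomials in commuting variables from \<open>'z\<close> are multisets, and a formal series is its function of
  coefficients. The series \<open>\<Sum>\<^bsub>s\<in>S\<^esub> \<mu> s\<close> of a family of monomials is \<open>monomial_series S \<mu>\<close>.
\<close>

definition monomial_series :: "'s set \<Rightarrow> ('s \<Rightarrow> 'z multiset) \<Rightarrow> 'z multiset \<Rightarrow> 'k::field" where
  "monomial_series S \<mu> = (\<lambda>m. of_nat (card {s \<in> S. \<mu> s = m}))"

definition M_series :: "'z::linorder set \<Rightarrow> nat list \<Rightarrow> 'z multiset \<Rightarrow> 'k::field" where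
  "M_series Z c = monomial_series
     {zs. set zs \<subseteq> Z \<and> length zs = length c \<and> sorted_wrt (<) zs}
     (\<lambda>zs. \<Sum>i<length c. replicate_mset (c ! i) (zs ! i))"

definition realize :: "'z::linorder set \<Rightarrow> (composition \<Rightarrow>\<^sub>0 'k::field) \<Rightarrow> 'z multiset \<Rightarrow> 'k" where
  "realize Z q = (\<lambda>m. \<Sum>c\<in>Poly_Mapping.keys q.
     Poly_Mapping.lookup q c * M_series Z (Rep_composition c) m)"

definition lin_maps :: "'z::linorder set \<Rightarrow> 'a topology \<Rightarrow> ('a \<Rightarrow> 'z) set" where
  "lin_maps Z T = {f \<in> topspace T \<rightarrow>\<^sub>E Z.
     \<forall>x\<in>topspace T. \<forall>y\<in>topspace T.
       (top_less T x y \<longrightarrow> f x < f y) \<and> (top_sim T x y \<longrightarrow> f x = f y)}"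

definition top_series :: "'z::linorder set \<Rightarrow> 'a topology \<Rightarrow> 'z multiset \<Rightarrow> 'k::field" where
  "top_series Z T = monomial_series (lin_maps Z T) (\<lambda>f. \<Sum>x\<in>topspace T. {#f x#})"

text \<open>
  The identification of \<open>QSym(Z)\<close> with \<open>QSym\<close>: \<open>lam Z\<close> sends the class of \<open>T\<close> to the element of
  \<open>QSym\<close> realized on \<open>Z\<close> by \<open>top_series Z T\<close>.
\<close>

definition lam :: "'z::linorder set \<Rightarrow> (ftop_class \<Rightarrow>\<^sub>0 'k::field) \<Rightarrow> (composition \<Rightarrow>\<^sub>0 'k)" where
  "lam Z = lin_ext (\<lambda>C. THE q. realize Z q = top_series Z (rep_ftop_class C))"

definition lin_set_compositions :: "'a topology \<Rightarrow> 'a set list set" where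
  "lin_set_compositions T = {Xs.
     {} \<notin> set Xs \<and> sorted_wrt disjnt Xs \<and> \<Union>(set Xs) = topspace T \<and>
     (\<forall>i<length Xs. \<forall>j<length Xs. \<forall>x\<in>Xs ! i. \<forall>y\<in>Xs ! j.
        (top_less T x y \<longrightarrow> i < j) \<and> (top_sim T x y \<longrightarrow> i = j))}"

end

theory Submission
  imports Defs
begin

text \<open>
  Write \<open>\<lambda>(T) = \<Sum> M(|X\<^sub>1|, \<dots>, |X\<^sub>k|)\<close> over the set compositions compatible with \<open>T\<close>, equivalently over the
  compatible surjections onto initial segments of the naturals. Every map into a linear order factors
  uniquely as such a surjection followed by an increasing list of values; this gives the realization
  on \<open>Z\<close>, and, applied to the restrictions of a surjection to two incomparable parts of a space,
  the quasi-shuffle product. Cutting a compatible set composition in two amounts to choosing an open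
  set and compatible set compositions of it and of its complement. For the internal coproduct, the
  pairs of an admissible \<open>T'\<close> and a set composition compatible with \<open>T/T'\<close> correspond to the weakly
  increasing set compositions of \<open>T\<close>, where \<open>T'\<close> is the disjoint union of the blocks; refining each
  block then gives the compatible set compositions of \<open>T\<close> cut into consecutive pieces.
\<close>

section \<open>Linear extension\<close>

text \<open>\<open>lam\<close> is a definite description evaluated at chosen representatives, so
  nothing can be computed from it directly. The work is done on \<open>lamT\<close>, which makes
  sense for finite spaces over any point type. Infinitely many variables make \<open>realize\<close>
  injective, which identifies the two, and invariance under homeomorphism replaces a representative
  by any space of its class. A compatible set composition has two encodings. As a map to the
  naturals it can be restricted, glued and composed with an increasing list, which suits the
  realization and the product. As a list of blocks it can be cut and concatenated, which suits both
  coproducts. For the internal coproduct, both sides are expanded over one index set,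
  \<open>block_compositions T\<close>, with the same summand; they differ only in the map by which
  this set is grouped, \<open>concat\<close> on one side and the union of each piece on the
  other.\<close>

abbreviation lin :: "(('b \<Rightarrow>\<^sub>0 'k::field) \<Rightarrow> ('c \<Rightarrow>\<^sub>0 'k)) \<Rightarrow> bool" where
  "lin f \<equiv> Vector_Spaces.linear smul smul f"

lemma lookup_smul [simp]: "Poly_Mapping.lookup (smul a p) b = a * Poly_Mapping.lookup p b"
  by (simp add: smul_def map.rep_eq when_def)

lemma lookup_bas: "Poly_Mapping.lookup (bas b) c = (if b = c then 1 else 0)"
  by (simp add: bas_def lookup_single when_def)

lemma vector_space_smul: "vector_space (smul :: 'k::field \<Rightarrow> ('b \<Rightarrow>\<^sub>0 'k) \<Rightarrow> _)"
  by unfold_locales (auto intro!: poly_mapping_eqI simp: lookup_add algebra_simps)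

lemma lin_iff: "lin f \<longleftrightarrow> (\<forall>x y. f (x + y) = f x + f y) \<and> (\<forall>a x. f (smul a x) = smul a (f x))"
  by (simp add: Vector_Spaces.linear_iff vector_space_smul)

lemma lin_add: "lin f \<Longrightarrow> f (x + y) = f x + f y"
  and lin_smul: "lin f \<Longrightarrow> f (smul a x) = smul a (f x)"
  by (simp_all add: lin_iff)

lemma lin_zero: "lin f \<Longrightarrow> f 0 = 0"
  using lin_add[of f 0 0] by simp

lemma lin_sum: "lin f \<Longrightarrow> f (sum g A) = (\<Sum>a\<in>A. f (g a))"
  by (induction A rule: infinite_finite_induct) (auto simp: lin_zero lin_add)

lemma lin_comp: "lin f \<Longrightarrow> lin g \<Longrightarrow> lin (\<lambda>x. f (g x))"
  by (simp add: lin_iff)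

lemma lin_ident: "lin (\<lambda>x. x)"
  by (simp add: lin_iff)

lemma smul_sum: "smul a (sum g A) = (\<Sum>x\<in>A. smul a (g x))"
  by (rule poly_mapping_eqI) (simp add: lookup_sum sum_distrib_left)

lemma smul_add_left: "smul (a + b) x = smul a x + smul b x"
  and smul_add_right: "smul a (x + y) = smul a x + smul a y"
  and smul_smul: "smul a (smul b x) = smul (a * b) x"
  and smul_one [simp]: "smul 1 x = x"
  and smul_zero [simp]: "smul 0 x = 0"
  by (auto intro!: poly_mapping_eqI simp: lookup_add algebra_simps)

text \<open>Cancellation can make the keys of a sum or of a scalar multiple smaller than expected,
  so linearity is checked over a common finite index set.\<close>

lemma lin_ext_superset:
  assumes "finite A" "Poly_Mapping.keys p \<subseteq> A"
  shows "lin_ext f p = (\<Sum>b\<in>A. smul (Poly_Mapping.lookup p b) (f b))"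
  unfolding lin_ext_def
  by (rule sum.mono_neutral_left[OF assms]) (auto simp: in_keys_iff)

lemma lin_lin_ext:
  fixes f :: "'b \<Rightarrow> ('c \<Rightarrow>\<^sub>0 'k::field)"
  shows "lin (lin_ext f)"
proof (unfold lin_iff, safe)
  fix x y :: "'b \<Rightarrow>\<^sub>0 'k"
  have "Poly_Mapping.keys (x + y) \<subseteq> Poly_Mapping.keys x \<union> Poly_Mapping.keys y" by (rule keys_add)
  then show "lin_ext f (x + y) = lin_ext f x + lin_ext f y"
    by (subst (1 2 3) lin_ext_superset[of "Poly_Mapping.keys x \<union> Poly_Mapping.keys y"])
       (auto simp: lookup_add smul_add_left sum.distrib)
next
  fix a and x :: "'b \<Rightarrow>\<^sub>0 'k"
  have "Poly_Mapping.keys (smul a x) \<subseteq> Poly_Mapping.keys x" by (auto simp: in_keys_iff)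
  then show "lin_ext f (smul a x) = smul a (lin_ext f x)"
    by (subst (1 2) lin_ext_superset[of "Poly_Mapping.keys x"])
       (auto simp: smul_sum smul_smul)
qed

lemma lin_ext_bas [simp]: "lin_ext f (bas b) = f b"
  by (simp add: lin_ext_def bas_def)

lemma lin_ext_bas_eq: "lin_ext bas p = p"
  by (rule poly_mapping_eqI)
     (auto simp: lin_ext_def lookup_sum lookup_bas if_distrib in_keys_iff cong: if_cong)

lemma lin_eqI:
  assumes "lin f" "lin g" "\<And>b. f (bas b) = g (bas b)"
  shows "f x = g x"
proof -
  have "f (lin_ext bas x) = g (lin_ext bas x)"
    unfolding lin_ext_def using assms by (simp add: lin_sum lin_smul)
  then show ?thesis by (simp add: lin_ext_bas_eq)
qed

lemma lin_ext_lin: "lin f \<Longrightarrow> lin_ext (\<lambda>b. f (bas b)) = f"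
  by (rule ext, rule lin_eqI) (auto intro: lin_lin_ext)

lemma lin_bilin_ext_left: "lin (\<lambda>x. bilin_ext f x y)"
  unfolding bilin_ext_def by (rule lin_lin_ext)

lemma lin_bilin_ext_right: "lin (bilin_ext f x)"
proof -
  have 1: "lin_ext (f b) (y + z) = lin_ext (f b) y + lin_ext (f b) z"
    and 2: "lin_ext (f b) (smul a y) = smul a (lin_ext (f b) y)" for b y z a
    using lin_lin_ext[of "f b"] by (simp_all add: lin_iff)
  show ?thesis
    unfolding lin_iff bilin_ext_def lin_ext_def[where p = x]
    by (auto simp: 1 2 smul_add_right sum.distrib smul_sum smul_smul mult.commute)
qed

lemma bilin_ext_bas [simp]: "bilin_ext f (bas b) (bas c) = f b c"
  by (simp add: bilin_ext_def)

lemma lin_tensor_left: "lin (\<lambda>x. tensor x y)"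
  unfolding tensor_def by (rule lin_bilin_ext_left)

lemma lin_tensor_right: "lin (tensor x)"
  unfolding tensor_def by (rule lin_bilin_ext_right)

lemma tensor_bas [simp]: "tensor (bas b) (bas c) = bas (b, c)"
  by (simp add: tensor_def)

lemma tensor_sum_left: "tensor (sum f A) y = (\<Sum>a\<in>A. tensor (f a) y)"
  by (rule lin_sum[OF lin_tensor_left])

lemma tensor_sum_right: "tensor x (sum f A) = (\<Sum>a\<in>A. tensor x (f a))"
  by (rule lin_sum[OF lin_tensor_right])

lemma lin_tensor_map: "lin (tensor_map f g)"
  unfolding tensor_map_def by (rule lin_lin_ext)

lemma bilin_eqI:
  assumes "\<And>y. lin (\<lambda>x. f x y)" "\<And>x. lin (f x)" "\<And>y. lin (\<lambda>x. g x y)" "\<And>x. lin (g x)"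
    and "\<And>b c. f (bas b) (bas c) = g (bas b) (bas c)"
  shows "f x y = g x y"
proof (rule lin_eqI[OF assms(1,3)])
  show "f (bas b) y = g (bas b) y" for b
    by (rule lin_eqI[OF assms(2,4,5)])
qed

text \<open>\<open>tensor_map\<close> is given by its values on pairs of basis elements; linearity
  of \<open>f\<close> and \<open>g\<close> is what extends the expected formula to all pure
  tensors.\<close>

lemma tensor_map_tensor:
  assumes "lin f" "lin g"
  shows "tensor_map f g (tensor x y) = tensor (f x) (g y)"
proof (rule bilin_eqI[of "\<lambda>x y. tensor_map f g (tensor x y)" "\<lambda>x y. tensor (f x) (g y)"])
  show "lin (\<lambda>x. tensor_map f g (tensor x y))" for y
    by (rule lin_comp[OF lin_tensor_map lin_tensor_left])
  show "lin (\<lambda>y. tensor_map f g (tensor x y))" for x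
    by (rule lin_comp[OF lin_tensor_map lin_tensor_right])
  show "lin (\<lambda>x. tensor (f x) (g y))" for y
    by (rule lin_comp[OF lin_tensor_left assms(1)])
  show "lin (\<lambda>y. tensor (f x) (g y))" for x
    by (rule lin_comp[OF lin_tensor_right assms(2)])
qed (simp add: tensor_map_def)

section \<open>Packed maps and set compositions\<close>

text \<open>The value at a point is the index, from 0, of its block. \<open>lin_maps\<close> makes
  the maps extensional, so equality on the space is equality.\<close>

definition packed_maps :: "'a topology \<Rightarrow> ('a \<Rightarrow> nat) set" where
  "packed_maps T = {f \<in> lin_maps UNIV T. \<exists>m. f ` topspace T = {..<m}}"

text \<open>The number of blocks is read off from the image, so no bound has to be carried along;
  for a map onto an initial segment these are exactly its nonempty fibers.\<close>

definition fibers :: "'a set \<Rightarrow> ('a \<Rightarrow> nat) \<Rightarrow> 'a set list" where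
  "fibers X f = map (\<lambda>j. {x \<in> X. f x = j}) [0..<card (f ` X)]"

lemma sorted_wrt_disjnt_iff:
  "sorted_wrt disjnt Xs \<longleftrightarrow>
     (\<forall>i<length Xs. \<forall>j<length Xs. i \<noteq> j \<longrightarrow> disjnt (Xs ! i) (Xs ! j))"
  unfolding sorted_wrt_iff_nth_less
  by (auto simp: disjnt_sym nat_neq_iff)

lemma fibers_in_lin_set_compositions:
  assumes f: "f \<in> packed_maps T"
  shows "fibers (topspace T) f \<in> lin_set_compositions T"
proof -
  let ?X = "topspace T"
  obtain m where m: "f ` ?X = {..<m}" using f by (auto simp: packed_maps_def)
  have cm: "card (f ` ?X) = m" by (simp add: m)
  have fx: "f x < m" if "x \<in> ?X" for x using m that by auto
  have fj: "\<exists>x\<in>?X. f x = j" if "j < m" for j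
  proof -
    have "j \<in> f ` ?X" using m that by simp
    then show ?thesis by auto
  qed
  have "{} \<notin> set (fibers ?X f)" using fj by (fastforce simp: fibers_def cm)
  moreover have "sorted_wrt disjnt (fibers ?X f)"
    by (auto simp: sorted_wrt_disjnt_iff fibers_def disjnt_def)
  moreover have "\<Union>(set (fibers ?X f)) = ?X"
    using fx by (auto simp: fibers_def cm)
  ultimately show ?thesis
    using f by (auto simp: lin_set_compositions_def packed_maps_def lin_maps_def fibers_def)
qed

text \<open>A point lies in the block whose index is its value, so the list determines the map.
  Conversely, disjointness of the blocks makes the index of the block containing a point unique, and
  this index is the required map.\<close>

lemma bij_betw_fibers:
  "bij_betw (fibers (topspace T)) (packed_maps T) (lin_set_compositions T)"
  unfolding bij_betw_def
proof
  let ?X = "topspace T"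
  show "inj_on (fibers ?X) (packed_maps T)"
  proof
    fix f g assume f: "f \<in> packed_maps T" and g: "g \<in> packed_maps T"
      and eq: "fibers ?X f = fibers ?X g"
    obtain m where m: "f ` ?X = {..<m}" using f by (auto simp: packed_maps_def)
    have len: "card (g ` ?X) = card (f ` ?X)" using arg_cong[OF eq, of length] by (simp add: fibers_def)
    show "f = g"
    proof (rule extensionalityI[of _ ?X])
      fix x assume x: "x \<in> ?X"
      have lt: "f x < card (f ` ?X)" using m x by auto
      have "x \<in> fibers ?X f ! f x" using x lt by (simp add: fibers_def)
      then have "x \<in> fibers ?X g ! f x" using eq by simp
      then show "f x = g x" using lt len by (simp add: fibers_def)
    qed (use f g in \<open>auto simp: packed_maps_def lin_maps_def PiE_def\<close>)
  qed
  show "fibers ?X ` packed_maps T = lin_set_compositions T"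
  proof
    show "fibers ?X ` packed_maps T \<subseteq> lin_set_compositions T"
      using fibers_in_lin_set_compositions by blast
    show "lin_set_compositions T \<subseteq> fibers ?X ` packed_maps T"
    proof
      fix Xs assume Xs: "Xs \<in> lin_set_compositions T"
      have ne: "{} \<notin> set Xs" and dj: "sorted_wrt disjnt Xs" and un: "\<Union>(set Xs) = ?X"
        and ls: "\<And>i j x y. i < length Xs \<Longrightarrow> j < length Xs \<Longrightarrow> x \<in> Xs ! i \<Longrightarrow> y \<in> Xs ! j \<Longrightarrow>
            (top_less T x y \<longrightarrow> i < j) \<and> (top_sim T x y \<longrightarrow> i = j)"
        using Xs by (auto simp: lin_set_compositions_def)
      define f where "f = (\<lambda>x\<in>?X. THE i. i < length Xs \<and> x \<in> Xs ! i)"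
      have f_eq: "f x = i" if "i < length Xs" "x \<in> Xs ! i" for i x
      proof -
        have x: "x \<in> ?X" using that un by (metis UnionI nth_mem)
        have uniq: "j = i" if "j < length Xs" "x \<in> Xs ! j" for j
          using dj[unfolded sorted_wrt_disjnt_iff] that \<open>i < length Xs\<close> \<open>x \<in> Xs ! i\<close>
          unfolding disjnt_iff by blast
        have "(THE j. j < length Xs \<and> x \<in> Xs ! j) = i"
          by (rule the_equality) (use that uniq in blast)+
        then show ?thesis using x by (simp add: f_def)
      qed
      have f_mem: "f x < length Xs \<and> x \<in> Xs ! f x" if "x \<in> ?X" for x
      proof -
        have "x \<in> \<Union>(set Xs)" using that un by simp
        then obtain i where "i < length Xs" "x \<in> Xs ! i" by (auto simp: in_set_conv_nth)
        then show ?thesis using f_eq[of i x] by simp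
      qed
      have sub: "Xs ! i \<subseteq> ?X" if "i < length Xs" for i
        unfolding un[symmetric] by (rule Union_upper) (simp add: that)
      have im: "f ` ?X = {..<length Xs}"
      proof
        show "f ` ?X \<subseteq> {..<length Xs}" using f_mem by auto
        show "{..<length Xs} \<subseteq> f ` ?X"
        proof
          fix i assume "i \<in> {..<length Xs}"
          then have i: "i < length Xs" by simp
          then obtain x where x: "x \<in> Xs ! i" using ne nth_mem[OF i] by (metis all_not_in_conv)
          have "f x = i" by (rule f_eq[OF i x])
          moreover have "x \<in> ?X" using sub[OF i] x by blast
          ultimately show "i \<in> f ` ?X" by blast
        qed
      qed
      have "fibers ?X f = Xs"
      proof (rule nth_equalityI)
        fix i assume "i < length (fibers ?X f)"
        then have "i < length Xs" by (simp add: fibers_def im)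
        then show "fibers ?X f ! i = Xs ! i"
          using f_eq[of i] f_mem sub[of i] by (auto simp: fibers_def im)
      qed (simp add: fibers_def im)
      moreover have "f \<in> packed_maps T"
      proof -
        have "f \<in> extensional ?X" by (simp add: f_def)
        moreover have "(top_less T x y \<longrightarrow> f x < f y) \<and> (top_sim T x y \<longrightarrow> f x = f y)"
          if "x \<in> ?X" "y \<in> ?X" for x y
          using ls[of "f x" "f y" x y] f_mem that by blast
        ultimately show ?thesis using im by (auto simp: packed_maps_def lin_maps_def PiE_def)
      qed
      ultimately show "Xs \<in> fibers ?X ` packed_maps T" by blast
    qed
  qed
qed

lemma finite_packed_maps: "finite (topspace T) \<Longrightarrow> finite (packed_maps T)"
proof (rule finite_subset)
  assume fin: "finite (topspace T)"
  show "packed_maps T \<subseteq> topspace T \<rightarrow>\<^sub>E {..card (topspace T)}"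
  proof
    fix f assume f: "f \<in> packed_maps T"
    then obtain m where m: "f ` topspace T = {..<m}" by (auto simp: packed_maps_def)
    have "m \<le> card (topspace T)" using card_image_le[OF fin, of f] m by simp
    moreover have "f x < m" if "x \<in> topspace T" for x
      using m that by blast
    ultimately have "f x \<le> card (topspace T)" if "x \<in> topspace T" for x
      using that by fastforce
    then show "f \<in> topspace T \<rightarrow>\<^sub>E {..card (topspace T)}"
      using f by (auto simp: packed_maps_def lin_maps_def PiE_def)
  qed
qed (auto intro: finite_PiE)

lemma finite_lin_set_compositions: "finite (topspace T) \<Longrightarrow> finite (lin_set_compositions T)"
  using bij_betw_finite[OF bij_betw_fibers[of T]] finite_packed_maps by blast

text \<open>\<open>M\<close> wraps its list by \<open>Abs_composition\<close>, which can be undone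
  only on lists of positive entries; the rules for the operations on \<open>M\<close> all ask for
  this.\<close>

lemma card_lin_set_composition_pos:
  assumes "finite (topspace T)" "Xs \<in> lin_set_compositions T"
  shows "\<forall>i\<in>set (map card Xs). 0 < i"
proof -
  have "0 < card A" if "A \<in> set Xs" for A
  proof -
    have "A \<subseteq> topspace T" "A \<noteq> {}" using assms(2) that by (auto simp: lin_set_compositions_def)
    then show ?thesis using assms(1) finite_subset card_gt_0_iff by blast
  qed
  then show ?thesis by simp
qed

section \<open>Factoring a map into a linear order through ranks\<close>

lemma rank_factorization_ex:
  fixes F :: "'a \<Rightarrow> 'z::linorder"
  assumes "finite X"
  shows "\<exists>f zs. f \<in> extensional X \<and> f ` X = {..<length zs} \<and> sorted_wrt (<) zs \<and>
    (\<forall>x\<in>X. F x = zs ! f x)"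
proof -
  \<comment> \<open>The list enumerates the values of \<open>F\<close> in increasing order, and
    \<open>f x\<close> will be the rank of \<open>F x\<close> among them.\<close>
  define zs where "zs = sorted_list_of_set (F ` X)"
  have zs: "sorted_wrt (<) zs" "set zs = F ` X" "distinct zs" using assms by (auto simp: zs_def)
  define f where "f = (\<lambda>x\<in>X. THE i. i < length zs \<and> zs ! i = F x)"
  have f_eq: "f x = i" if "x \<in> X" "i < length zs" "zs ! i = F x" for x i
    unfolding f_def using that zs(3)
    by (simp, intro the_equality) (auto simp flip: nth_eq_iff_index_eq[OF zs(3)])
  have f_mem: "f x < length zs \<and> zs ! f x = F x" if x: "x \<in> X" for x
  proof -
    have "F x \<in> set zs" using zs(2) x by blast
    then obtain i where "i < length zs" "zs ! i = F x" by (auto simp: in_set_conv_nth)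
    then show ?thesis using f_eq[OF x, of i] by simp
  qed
  have "i \<in> f ` X" if i: "i < length zs" for i
  proof -
    obtain x where "x \<in> X" "zs ! i = F x" using zs(2) i nth_mem by blast
    then show ?thesis using f_eq i by (metis imageI)
  qed
  then have "f ` X = {..<length zs}" using f_mem by auto
  moreover have "f \<in> extensional X" by (simp add: f_def)
  ultimately show ?thesis using zs f_mem by metis
qed

lemma set_rank_factorization:
  assumes "f ` X = {..<length zs}" "\<forall>x\<in>X. F x = zs ! f x"
  shows "set zs = F ` X"
proof -
  have "set zs = (!) zs ` (f ` X)" using assms(1) by (auto simp: set_conv_nth)
  also have "\<dots> = F ` X" using assms(2) by (auto simp: image_image)
  finally show ?thesis .
qed

text \<open>The set of values forces the strictly sorted list, and in a distinct list an entry
  forces its index. Besides the realization, this identifies quasi-shuffles.\<close>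

lemma rank_factorization_unique:
  fixes F :: "'a \<Rightarrow> 'z::linorder"
  assumes "f \<in> extensional X" "f ` X = {..<length zs}" "sorted_wrt (<) zs" "\<forall>x\<in>X. F x = zs ! f x"
    and "g \<in> extensional X" "g ` X = {..<length ws}" "sorted_wrt (<) ws" "\<forall>x\<in>X. F x = ws ! g x"
  shows "f = g \<and> zs = ws"
proof -
  have "set zs = set ws" using set_rank_factorization assms by metis
  then have eq: "zs = ws" using assms(3,7) strict_sorted_equal by blast
  have "distinct zs" using assms(3) strict_sorted_iff by blast
  moreover have "zs ! f x = zs ! g x" if "x \<in> X" for x using assms(4,8) eq that by metis
  moreover have "f x < length zs \<and> g x < length zs" if "x \<in> X" for x
    using assms(2,6) eq that by blast
  ultimately have "f x = g x" if "x \<in> X" for x using that by (metis nth_eq_iff_index_eq)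
  then show ?thesis using assms(1,5) eq extensionalityI by blast
qed

section \<open>Realization\<close>

text \<open>The monomial with variables \<open>zs\<close> and exponents \<open>c\<close>, as it
  occurs in \<open>M_series\<close>.\<close>

definition wmono :: "nat list \<Rightarrow> 'z list \<Rightarrow> 'z multiset" where
  "wmono c zs = (\<Sum>i<length c. replicate_mset (c ! i) (zs ! i))"

lemma count_wmono:
  assumes "distinct zs" "length zs = length c" "j < length c"
  shows "count (wmono c zs) (zs ! j) = c ! j"
proof -
  have "count (wmono c zs) (zs ! j) = (\<Sum>i<length c. if i = j then c ! i else 0)"
    unfolding wmono_def count_sum
    by (rule sum.cong) (use assms in \<open>auto simp: nth_eq_iff_index_eq\<close>)
  then show ?thesis using assms(3) by simp
qed

lemma set_mset_wmono:
  assumes "length zs = length c" "\<forall>i\<in>set c. 0 < i"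
  shows "set_mset (wmono c zs) = set zs"
proof -
  have "set_mset (wmono c zs) = (\<Union>i<length c. set_mset (replicate_mset (c ! i) (zs ! i)))"
    by (simp add: wmono_def set_mset_sum)
  also have "\<dots> = (\<Union>i<length c. {zs ! i})"
    by (rule SUP_cong) (use assms nth_mem in \<open>auto simp: set_mset_replicate_mset_subset\<close>)
  also have "\<dots> = set zs" using assms(1) by (auto simp: set_conv_nth)
  finally show ?thesis .
qed

text \<open>All exponents being positive, the support of the monomial is the set of its variables;
  their order is forced by sortedness, and the multiplicities are the exponents.\<close>

lemma wmono_eqD:
  fixes zs ws :: "'z::linorder list"
  assumes "wmono c zs = wmono d ws" "length zs = length c" "length ws = length d"
    and "sorted_wrt (<) zs" "sorted_wrt (<) ws" "\<forall>i\<in>set c. 0 < i" "\<forall>i\<in>set d. 0 < i"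
  shows "zs = ws \<and> c = d"
proof -
  have "set zs = set ws" using set_mset_wmono assms by metis
  then have eq: "zs = ws" using assms(4,5) strict_sorted_equal by blast
  have "distinct zs" using assms(4) strict_sorted_iff by blast
  then have "c = d"
    using assms(1-3) eq by (intro nth_equalityI) (metis count_wmono)+
  with eq show ?thesis by simp
qed

lemma M_series_wmono:
  fixes zs :: "'z::linorder list"
  assumes "set zs \<subseteq> Z" "length zs = length c" "sorted_wrt (<) zs"
    and "\<forall>i\<in>set c. 0 < i" "\<forall>i\<in>set d. 0 < i"
  shows "M_series Z d (wmono c zs) = (if c = d then 1 else 0 :: 'k::field)"
proof -
  have "{ws \<in> {ws. set ws \<subseteq> Z \<and> length ws = length d \<and> sorted_wrt (<) ws}. wmono d ws = wmono c zs}
      = (if c = d then {zs} else {})" (is "?S = _")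
    using wmono_eqD[of c zs d, OF sym] assms by (auto split: if_splits)
  then have "of_nat (card ?S) = (if c = d then 1 else 0 :: 'k)" by simp
  then show ?thesis unfolding M_series_def monomial_series_def wmono_def[symmetric] .
qed

text \<open>A monomial with exponents \<open>c\<close> in increasing variables has coefficient 1 in
  the series of \<open>c\<close> and 0 in that of any other composition, so each coefficient of an
  element is a coefficient of its series. Infinitely many variables accommodate compositions of
  every length.\<close>

lemma realize_inj:
  fixes Z :: "'z::linorder set" and p q :: "composition \<Rightarrow>\<^sub>0 'k::field"
  assumes "infinite Z" "realize Z p = realize Z q"
  shows "p = q"
proof (rule poly_mapping_eqI)
  fix c
  let ?c = "Rep_composition c"
  obtain A where A: "A \<subseteq> Z" "finite A" "card A = length ?c"
    using infinite_arbitrarily_large[OF assms(1)] by blast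
  define zs where "zs = sorted_list_of_set A"
  have zs: "set zs \<subseteq> Z" "length zs = length ?c" "sorted_wrt (<) zs"
    using A by (auto simp: zs_def)
  have "realize Z r (wmono ?c zs) = Poly_Mapping.lookup r c" for r :: "composition \<Rightarrow>\<^sub>0 'k"
  proof -
    have "realize Z r (wmono ?c zs)
        = (\<Sum>d\<in>Poly_Mapping.keys r. if c = d then Poly_Mapping.lookup r d else 0)"
      unfolding realize_def
    proof (rule sum.cong[OF refl])
      fix d
      show "Poly_Mapping.lookup r d * M_series Z (Rep_composition d) (wmono ?c zs)
          = (if c = d then Poly_Mapping.lookup r d else 0)"
        using Rep_composition[of c] Rep_composition[of d] zs
        by (subst M_series_wmono) (auto simp: Rep_composition_inject)
    qed
    then show ?thesis by (simp add: in_keys_iff)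
  qed
  then show "Poly_Mapping.lookup p c = Poly_Mapping.lookup q c" using assms(2) by metis
qed

lemma realize_superset:
  assumes "finite A" "Poly_Mapping.keys q \<subseteq> A"
  shows "realize Z q m = (\<Sum>c\<in>A. Poly_Mapping.lookup q c * M_series Z (Rep_composition c) m)"
  unfolding realize_def by (rule sum.mono_neutral_left[OF assms]) (auto simp: in_keys_iff)

lemma realize_add: "realize Z (p + q) m = realize Z p m + realize Z q m"
proof -
  let ?A = "Poly_Mapping.keys p \<union> Poly_Mapping.keys q"
  have "Poly_Mapping.keys (p + q) \<subseteq> ?A" by (rule keys_add)
  then show ?thesis
    by (subst (1 2 3) realize_superset[of ?A]) (auto simp: lookup_add algebra_simps sum.distrib)
qed

lemma realize_sum: "realize Z (sum q A) m = (\<Sum>a\<in>A. realize Z (q a) m)"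
  by (induction A rule: infinite_finite_induct) (auto simp: realize_add realize_def[of _ 0])

lemma realize_M: "\<forall>i\<in>set c. 0 < i \<Longrightarrow> realize Z (M c) = M_series Z c"
  by (auto simp: realize_def M_def bas_def Abs_composition_inverse)

text \<open>The map of the theorem on a single space: no alphabet, no definite description, no
  representative.\<close>

definition lamT :: "'a topology \<Rightarrow> (composition \<Rightarrow>\<^sub>0 'k::field)" where
  "lamT T = (\<Sum>Xs\<in>lin_set_compositions T. M (map card Xs))"

lemma lamT_packed: "lamT T = (\<Sum>f\<in>packed_maps T. M (map card (fibers (topspace T) f)))"
  unfolding lamT_def by (rule sum.reindex_bij_betw[OF bij_betw_fibers, symmetric])

lemma wmono_fibers:
  assumes "finite X" "f ` X = {..<length zs}"
  shows "wmono (map card (fibers X f)) zs = (\<Sum>x\<in>X. {#zs ! f x#})"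
proof -
  have "(\<Sum>x\<in>X. {#zs ! f x#}) = (\<Sum>i<length zs. \<Sum>x | x \<in> X \<and> f x = i. {#zs ! f x#})"
    by (rule sum.group[symmetric]) (use assms in auto)
  also have "\<dots> = (\<Sum>i<length zs. replicate_mset (card {x \<in> X. f x = i}) (zs ! i))"
  proof (rule sum.cong[OF refl])
    fix i
    have "(\<Sum>x | x \<in> X \<and> f x = i. {#zs ! f x#}) = (\<Sum>x | x \<in> X \<and> f x = i. {#zs ! i#})"
      by (rule sum.cong) auto
    also have "\<dots> = replicate_mset (card {x \<in> X. f x = i}) (zs ! i)"
      by (rule multiset_eqI) (simp add: count_sum)
    finally show "(\<Sum>x | x \<in> X \<and> f x = i. {#zs ! f x#}) = replicate_mset (card {x \<in> X. f x = i}) (zs ! i)" .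
  qed
  finally show ?thesis using assms(2) by (simp add: wmono_def fibers_def)
qed

text \<open>A strictly increasing list preserves and reflects \<open><\<close> and \<open>=\<close>,
  so \<open>F\<close> and its rank map \<open>f\<close> satisfy the same conditions of
  compatibility, and \<open>Z\<close> constrains only the list. The product uses the case of the
  alphabet \<open>UNIV\<close>.\<close>

lemma lin_maps_factorization:
  assumes "f \<in> extensional (topspace T)" "f ` topspace T = {..<length zs}" "sorted_wrt (<) zs"
    "\<forall>x\<in>topspace T. F x = zs ! f x" "F \<in> extensional (topspace T)"
  shows "F \<in> lin_maps Z T \<longleftrightarrow> f \<in> packed_maps T \<and> set zs \<subseteq> Z"
proof -
  let ?X = "topspace T"
  have d: "distinct zs" using assms(3) strict_sorted_iff by blast
  have lt: "f x < length zs" if "x \<in> ?X" for x using assms(2) that by blast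
  have 1: "F x < F y \<longleftrightarrow> f x < f y" if "x \<in> ?X" "y \<in> ?X" for x y
    using assms(3,4) that lt sorted_wrt_nth_less[OF assms(3)]
    by (metis linorder_cases order_less_asym order_less_irrefl)
  have 2: "F x = F y \<longleftrightarrow> f x = f y" if "x \<in> ?X" "y \<in> ?X" for x y
    using assms(4) that lt d by (metis nth_eq_iff_index_eq)
  have 3: "set zs \<subseteq> Z \<longleftrightarrow> F \<in> ?X \<rightarrow> Z"
    using set_rank_factorization[OF assms(2,4)] by auto
  show ?thesis
    unfolding packed_maps_def lin_maps_def using assms(1,2,5) 1 2 3 by (auto simp: PiE_def)
qed

text \<open>For a fixed monomial \<open>m\<close>, both sides count the same maps: rank
  factorization turns a compatible map into \<open>Z\<close> with monomial \<open>m\<close> into a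
  packed map together with an increasing list of variables.\<close>

lemma realize_lamT:
  fixes T :: "'a topology" and Z :: "'z::linorder set"
  assumes fin: "finite (topspace T)"
  shows "realize Z (lamT T) = (top_series Z T :: _ \<Rightarrow> 'k::field)"
proof
  fix m
  let ?X = "topspace T"
  let ?wt = "\<lambda>f. map card (fibers ?X f)"
  let ?S = "\<lambda>f. {zs \<in> {zs. set zs \<subseteq> Z \<and> length zs = length (?wt f) \<and> sorted_wrt (<) zs}. wmono (?wt f) zs = m}"
  let ?F = "{F \<in> lin_maps Z T. (\<Sum>x\<in>?X. {#F x#}) = m}"
  have pos: "\<forall>i\<in>set (?wt f). 0 < i" if "f \<in> packed_maps T" for f
    by (rule card_lin_set_composition_pos[OF fin fibers_in_lin_set_compositions[OF that]])
  have len: "f ` ?X = {..<length (?wt f)}" if f: "f \<in> packed_maps T" for f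
  proof -
    obtain n where "f ` ?X = {..<n}" using f by (auto simp: packed_maps_def)
    then show ?thesis by (simp add: fibers_def)
  qed
  \<comment> \<open>Counting the pairs requires finitely many lists, although \<open>Z\<close> may
    supply infinitely many variables: only variables that occur in \<open>m\<close> can be
    used.\<close>
  have finS: "finite (?S f)" if "f \<in> packed_maps T" for f
  proof (rule finite_subset)
    show "?S f \<subseteq> {zs. set zs \<subseteq> set_mset m \<and> length zs = length (?wt f)}"
      using set_mset_wmono pos[OF that] by blast
    show "finite {zs. set zs \<subseteq> set_mset m \<and> length zs = length (?wt f)}"
      by (rule finite_lists_length_eq) simp
  qed
  let ?h = "\<lambda>(f, zs). \<lambda>x\<in>?X. zs ! f x"
  have "bij_betw ?h (Sigma (packed_maps T) ?S) ?F"
    unfolding bij_betw_def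
  proof
    have fact: "f \<in> extensional ?X \<and> f ` ?X = {..<length zs} \<and> sorted_wrt (<) zs"
      if "f \<in> packed_maps T" "zs \<in> ?S f" for f zs
      using that len[OF that(1)] by (auto simp: packed_maps_def lin_maps_def PiE_def)
    show "inj_on ?h (Sigma (packed_maps T) ?S)"
    proof (rule inj_onI, clarify)
      fix f zs g ws
      assume f: "f \<in> packed_maps T" and g: "g \<in> packed_maps T"
        and eq: "(\<lambda>x\<in>?X. zs ! f x) = (\<lambda>x\<in>?X. ws ! g x)"
        and zs: "set zs \<subseteq> Z" "length zs = length (?wt f)" "sorted_wrt (<) zs" "m = wmono (?wt f) zs"
        and ws: "set ws \<subseteq> Z" "length ws = length (?wt g)" "sorted_wrt (<) ws"
          "wmono (?wt g) ws = wmono (?wt f) zs"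
      show "f = g \<and> zs = ws"
      proof (rule rank_factorization_unique)
        show "\<forall>x\<in>?X. (\<lambda>x\<in>?X. zs ! f x) x = zs ! f x" by simp
        show "\<forall>x\<in>?X. (\<lambda>x\<in>?X. zs ! f x) x = ws ! g x" unfolding eq by simp
      qed (use fact[OF f, of zs] fact[OF g, of ws] zs ws in auto)
    qed
    show "?h ` Sigma (packed_maps T) ?S = ?F"
    proof safe
      fix f zs assume f: "f \<in> packed_maps T"
        and zs: "set zs \<subseteq> Z" "length zs = length (?wt f)" "sorted_wrt (<) zs" "m = wmono (?wt f) zs"
      have fc: "f \<in> extensional ?X" "f ` ?X = {..<length zs}" using fact[OF f, of zs] zs by auto
      show "(\<lambda>x\<in>?X. zs ! f x) \<in> lin_maps Z T"
        by (subst lin_maps_factorization[OF fc zs(3)]) (use f zs in auto)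
      have "(\<Sum>x\<in>?X. {#(\<lambda>x\<in>?X. zs ! f x) x#}) = (\<Sum>x\<in>?X. {#zs ! f x#})" by (rule sum.cong) auto
      then show "(\<Sum>x\<in>?X. {#(\<lambda>x\<in>?X. zs ! f x) x#}) = wmono (?wt f) zs"
        using wmono_fibers[OF fin fc(2)] by simp
    next
      fix F assume F: "F \<in> lin_maps Z T" "m = (\<Sum>x\<in>?X. {#F x#})"
      obtain f zs where fz: "f \<in> extensional ?X" "f ` ?X = {..<length zs}" "sorted_wrt (<) zs"
        "\<forall>x\<in>?X. F x = zs ! f x"
        using rank_factorization_ex[OF fin, of F] by blast
      have Fe: "F \<in> extensional ?X" using F(1) by (auto simp: lin_maps_def PiE_def)
      have f: "f \<in> packed_maps T" "set zs \<subseteq> Z"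
        using lin_maps_factorization[OF fz Fe] F(1) by auto
      have "wmono (?wt f) zs = (\<Sum>x\<in>?X. {#F x#})"
        using wmono_fibers[OF fin fz(2)] fz(4) by simp
      moreover have "length zs = length (?wt f)" using fz(2) by (simp add: fibers_def)
      moreover have "F = (\<lambda>x\<in>?X. zs ! f x)"
        by (rule extensionalityI[OF Fe]) (use fz(4) in auto)
      ultimately have "F = ?h (f, zs)" "(f, zs) \<in> Sigma (packed_maps T) (\<lambda>f. {zs \<in> {zs. set zs \<subseteq> Z \<and> length zs = length (?wt f) \<and> sorted_wrt (<) zs}. wmono (?wt f) zs = (\<Sum>x\<in>?X. {#F x#})})"
        using f fz(3) by auto
      then show "F \<in> ?h ` Sigma (packed_maps T) (\<lambda>f. {zs \<in> {zs. set zs \<subseteq> Z \<and> length zs = length (?wt f) \<and> sorted_wrt (<) zs}. wmono (?wt f) zs = (\<Sum>x\<in>?X. {#F x#})})"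
        by (rule image_eqI)
    qed
  qed
  from bij_betw_same_card[OF this] have "card ?F = card (Sigma (packed_maps T) ?S)" by (rule sym)
  moreover have "card (Sigma (packed_maps T) ?S) = (\<Sum>f\<in>packed_maps T. card (?S f))"
    by (rule card_SigmaI[OF finite_packed_maps[OF fin]]) (use finS in blast)
  ultimately have c: "card ?F = (\<Sum>f\<in>packed_maps T. card (?S f))" by (rule trans)
  have S: "(of_nat (card (?S f)) :: 'k) = realize Z (M (?wt f)) m" if f: "f \<in> packed_maps T" for f
    unfolding realize_M[OF pos[OF f]] M_series_def monomial_series_def wmono_def ..
  have e: "(of_nat (card ?F) :: 'k) = (\<Sum>f\<in>packed_maps T. realize Z (M (?wt f)) m)"
    unfolding c of_nat_sum by (rule sum.cong[OF refl S])
  show "realize Z (lamT T) m = (top_series Z T m :: 'k)"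
    by (simp only: lamT_packed realize_sum top_series_def monomial_series_def e)
qed

section \<open>Finite spaces as quasi-orders\<close>

lemma top_le_refl: "x \<in> topspace T \<Longrightarrow> top_le T x x"
  by (simp add: top_le_def)

lemma top_le_trans: "top_le T x y \<Longrightarrow> top_le T y z \<Longrightarrow> top_le T x z"
  by (simp add: top_le_def)

lemma top_leD: "top_le T x y \<Longrightarrow> x \<in> topspace T \<and> y \<in> topspace T"
  by (simp add: top_le_def)

text \<open>In a finite space the intersection of all open neighbourhoods of a point is open, and it
  consists of the points above it; an upwards closed set is a union of such neighbourhoods.\<close>

lemma openin_iff_top_le:
  assumes "finite (topspace T)"
  shows "openin T U \<longleftrightarrow> U \<subseteq> topspace T \<and> (\<forall>x\<in>U. \<forall>y. top_le T x y \<longrightarrow> y \<in> U)"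
proof
  assume "openin T U"
  then show "U \<subseteq> topspace T \<and> (\<forall>x\<in>U. \<forall>y. top_le T x y \<longrightarrow> y \<in> U)"
    by (auto simp: top_le_def dest: openin_subset)
next
  assume U: "U \<subseteq> topspace T \<and> (\<forall>x\<in>U. \<forall>y. top_le T x y \<longrightarrow> y \<in> U)"
  have "\<exists>V. openin T V \<and> x \<in> V \<and> V \<subseteq> U" if x: "x \<in> U" for x
  proof -
    let ?N = "{V. openin T V \<and> x \<in> V}"
    have "?N \<subseteq> Pow (topspace T)" by (auto dest: openin_subset)
    then have "finite ?N" using assms finite_subset by blast
    moreover have "topspace T \<in> ?N" using x U by auto
    ultimately have "openin T (\<Inter>?N)" by (intro openin_Inter) auto
    moreover have "\<Inter>?N \<subseteq> U"
    proof
      fix y assume y: "y \<in> \<Inter>?N"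
      then have "y \<in> topspace T" using \<open>topspace T \<in> ?N\<close> by blast
      then have "top_le T x y" using x U y by (auto simp: top_le_def)
      then show "y \<in> U" using U x by blast
    qed
    ultimately show ?thesis by blast
  qed
  then show "openin T U" by (subst openin_subopen) blast
qed

lemma topology_eq_top_leI:
  assumes "finite (topspace T)" "topspace S = topspace T" "\<And>x y. top_le S x y \<longleftrightarrow> top_le T x y"
  shows "S = T"
  unfolding topology_eq using assms by (simp add: openin_iff_top_le)

lemma top_le_subtopology: "top_le (subtopology T Y) x y \<longleftrightarrow> x \<in> Y \<and> y \<in> Y \<and> top_le T x y"
  by (auto simp: top_le_def openin_subtopology)

lemma top_le_homeomorphic_map:
  assumes "homeomorphic_map S T h" "x \<in> topspace S" "y \<in> topspace S"
  shows "top_le T (h x) (h y) \<longleftrightarrow> top_le S x y"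
proof -
  obtain g where g: "homeomorphic_maps S T h g" using assms(1) by (auto simp: homeomorphic_map_maps)
  have h: "continuous_map S T h" and gh: "\<And>z. z \<in> topspace S \<Longrightarrow> g (h z) = z"
    and gc: "continuous_map T S g"
    using g by (auto simp: homeomorphic_maps_def)
  have hx: "h x \<in> topspace T" "h y \<in> topspace T"
    using h assms(2,3) by (auto simp: continuous_map_def)
  show ?thesis
  proof
    assume le: "top_le T (h x) (h y)"
    have "y \<in> U" if U: "openin S U" "x \<in> U" for U
    proof -
      have "openin T {z \<in> topspace T. g z \<in> U}" using gc U by (auto simp: continuous_map_def)
      moreover have "h x \<in> {z \<in> topspace T. g z \<in> U}" using hx gh assms U by auto
      ultimately have "h y \<in> {z \<in> topspace T. g z \<in> U}" using le unfolding top_le_def by blast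
      then show ?thesis using gh assms(3) by auto
    qed
    then show "top_le S x y" using assms by (auto simp: top_le_def)
  next
    assume le: "top_le S x y"
    have "h y \<in> U" if U: "openin T U" "h x \<in> U" for U
    proof -
      have "openin S {z \<in> topspace S. h z \<in> U}" using h U by (auto simp: continuous_map_def)
      moreover have "x \<in> {z \<in> topspace S. h z \<in> U}" using assms U by auto
      ultimately have "y \<in> {z \<in> topspace S. h z \<in> U}" using le unfolding top_le_def by blast
      then show ?thesis by auto
    qed
    then show "top_le T (h x) (h y)" using hx by (auto simp: top_le_def)
  qed
qed

text \<open>The condition on an earlier block \<open>A\<close> and a later block \<open>B\<close>:
  no relation leads back. Being a condition on pairs of points, it passes to unions; reflexivity
  makes such blocks of a space disjoint.\<close>

definition below :: "'a topology \<Rightarrow> 'a set \<Rightarrow> 'a set \<Rightarrow> bool" where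
  "below T A B \<longleftrightarrow> (\<forall>x\<in>A. \<forall>y\<in>B. \<not> top_le T y x)"

text \<open>The condition on a single block: a map that is constant on it tolerates equivalences but
  no strict relations.\<close>

definition flat :: "'a topology \<Rightarrow> 'a set \<Rightarrow> bool" where
  "flat T A \<longleftrightarrow> (\<forall>x\<in>A. \<forall>y\<in>A. top_le T x y \<longrightarrow> top_le T y x)"

text \<open>The conditions on indices separate into one on pairs of blocks and one on single blocks,
  and disjointness follows, since a common point would be related to itself. In this form,
  \<open>sorted_wrt\<close> handles cutting and concatenation.\<close>

lemma lin_set_compositions_iff:
  "Xs \<in> lin_set_compositions T \<longleftrightarrow>
     {} \<notin> set Xs \<and> \<Union>(set Xs) = topspace T \<and> sorted_wrt (below T) Xs \<and> (\<forall>A\<in>set Xs. flat T A)"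
    (is "_ \<longleftrightarrow> ?R")
proof
  assume Xs: "Xs \<in> lin_set_compositions T"
  then have ls: "(top_less T x y \<longrightarrow> i < j) \<and> (top_sim T x y \<longrightarrow> i = j)"
    if "i < length Xs" "j < length Xs" "x \<in> Xs ! i" "y \<in> Xs ! j" for i j x y
    using that by (auto simp: lin_set_compositions_def)
  have "sorted_wrt (below T) Xs"
    unfolding sorted_wrt_iff_nth_less below_def
  proof (intro allI impI ballI)
    fix i j x y assume ij: "i < j" "j < length Xs" and x: "x \<in> Xs ! i" and y: "y \<in> Xs ! j"
    have "i < length Xs" using ij by simp
    then show "\<not> top_le T y x"
      using ls[OF ij(2) _ y x] ij unfolding top_less_def top_sim_def by auto
  qed
  moreover have "flat T A" if A: "A \<in> set Xs" for A
  proof -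
    obtain i where i: "i < length Xs" "A = Xs ! i" using A by (auto simp: in_set_conv_nth)
    show ?thesis using ls[OF i(1) i(1)] unfolding flat_def i(2) top_less_def by blast
  qed
  ultimately show ?R using Xs by (auto simp: lin_set_compositions_def)
next
  assume R: ?R
  have sub: "Xs ! i \<subseteq> topspace T" if "i < length Xs" for i
    using R that nth_mem by blast
  have bl: "\<not> top_le T y x" if "i < j" "j < length Xs" "x \<in> Xs ! i" "y \<in> Xs ! j" for i j x y
    using R that by (auto simp: sorted_wrt_iff_nth_less below_def)
  have "sorted_wrt disjnt Xs"
    unfolding sorted_wrt_iff_nth_less disjnt_iff
  proof (intro allI impI, rule notI)
    fix i j x assume ij: "i < j" "j < length Xs" and x: "x \<in> Xs ! i \<and> x \<in> Xs ! j"
    then have "x \<in> topspace T" using sub by blast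
    then show False using bl[OF ij, of x x] x top_le_refl[of x T] by auto
  qed
  moreover have "(top_less T x y \<longrightarrow> i < j) \<and> (top_sim T x y \<longrightarrow> i = j)"
    if ij: "i < length Xs" "j < length Xs" and x: "x \<in> Xs ! i" and y: "y \<in> Xs ! j" for i j x y
  proof -
    have "flat T (Xs ! i)" using R ij by simp
    then have "i = j \<Longrightarrow> \<not> top_less T x y" using x y by (auto simp: flat_def top_less_def)
    moreover have "j < i \<Longrightarrow> \<not> top_le T x y" using bl[OF _ ij(1) y x] by blast
    moreover have "i < j \<Longrightarrow> \<not> top_le T y x" using bl[OF _ ij(2) x y] by blast
    ultimately show ?thesis unfolding top_less_def top_sim_def by (metis linorder_neqE_nat)
  qed
  ultimately show "Xs \<in> lin_set_compositions T"
    using R by (auto simp: lin_set_compositions_def)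
qed

section \<open>Invariance under homeomorphism\<close>

lemma lin_set_compositions_homeomorphic:
  assumes h: "homeomorphic_map S T h" and Xs: "Xs \<in> lin_set_compositions S"
  shows "map (image h) Xs \<in> lin_set_compositions T"
proof -
  have sub: "A \<subseteq> topspace S" if "A \<in> set Xs" for A
    using Xs that by (auto simp: lin_set_compositions_iff)
  have un: "\<Union>(set Xs) = topspace S" using Xs by (auto simp: lin_set_compositions_iff)
  have "\<Union>(set (map (image h) Xs)) = h ` \<Union>(set Xs)" by auto
  also have "\<dots> = topspace T" using un homeomorphic_imp_surjective_map[OF h] by simp
  finally have 1: "\<Union>(set (map (image h) Xs)) = topspace T" .
  have "sorted_wrt (\<lambda>A B. below T (h ` A) (h ` B)) Xs"
  proof (rule sorted_wrt_mono_rel[of Xs "below S"])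
    show "sorted_wrt (below S) Xs" using Xs by (simp add: lin_set_compositions_iff)
    show "below T (h ` A) (h ` B)" if "A \<in> set Xs" "B \<in> set Xs" "below S A B" for A B
      using that(3) sub[OF that(1)] sub[OF that(2)] top_le_homeomorphic_map[OF h]
      unfolding below_def by blast
  qed
  then have 2: "sorted_wrt (below T) (map (image h) Xs)" by (simp add: sorted_wrt_map)
  have 3: "flat T (h ` A)" if "A \<in> set Xs" for A
  proof -
    have "flat S A" using Xs that by (simp add: lin_set_compositions_iff)
    then show ?thesis using sub[OF that] top_le_homeomorphic_map[OF h] unfolding flat_def by blast
  qed
  show ?thesis using 1 2 3 Xs by (auto simp: lin_set_compositions_iff)
qed

lemma lamT_homeomorphic:
  assumes "S homeomorphic_space T"
  shows "lamT S = lamT T"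
proof -
  obtain h g where hg: "homeomorphic_maps S T h g" using assms by (auto simp: homeomorphic_space_def)
  have h: "homeomorphic_map S T h" and g: "homeomorphic_map T S g"
    using hg homeomorphic_maps_map homeomorphic_maps_sym by blast+
  have gh: "\<And>x. x \<in> topspace S \<Longrightarrow> g (h x) = x" and hg': "\<And>x. x \<in> topspace T \<Longrightarrow> h (g x) = x"
    using hg by (auto simp: homeomorphic_maps_def)
  have sub: "\<Union>(set Xs) = topspace S" if "Xs \<in> lin_set_compositions S" for Xs
    using that by (auto simp: lin_set_compositions_def)
  have sub': "\<Union>(set Xs) = topspace T" if "Xs \<in> lin_set_compositions T" for Xs
    using that by (auto simp: lin_set_compositions_def)
  show ?thesis unfolding lamT_def
  proof (rule sum.reindex_bij_witness[of _ "map (image g)" "map (image h)"])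
    fix Xs assume Xs: "Xs \<in> lin_set_compositions S"
    show "map (image g) (map (image h) Xs) = Xs"
      using sub[OF Xs] gh by (auto intro!: map_idI simp: image_image) force+
    show "map (image h) Xs \<in> lin_set_compositions T"
      by (rule lin_set_compositions_homeomorphic[OF h Xs])
    have "card (h ` A) = card A" if "A \<in> set Xs" for A
      using sub[OF Xs] gh that by (intro card_image inj_onI) (metis UnionI)
    then have "map card (map (image h) Xs) = map card Xs" by simp
    then show "M (map card (map (image h) Xs)) = M (map card Xs)" by (rule arg_cong)
  next
    fix Xs assume Xs: "Xs \<in> lin_set_compositions T"
    show "map (image h) (map (image g) Xs) = Xs"
      using sub'[OF Xs] hg' by (auto intro!: map_idI simp: image_image) force+
    show "map (image g) Xs \<in> lin_set_compositions S"
      by (rule lin_set_compositions_homeomorphic[OF g Xs])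
  qed
qed

section \<open>Representatives of homeomorphism classes\<close>

lemma ex_nat_homeomorphic:
  assumes "finite (topspace T)"
  shows "\<exists>S :: nat topology. S homeomorphic_space T"
proof -
  obtain f :: "_ \<Rightarrow> nat" where f: "inj_on f (topspace T)"
    using finite_imp_inj_to_nat_seg[OF assms] by blast
  let ?X = "topspace T"
  let ?g = "inv_into ?X f"
  \<comment> \<open>The topology is transported to a set of numbers by pulling it back along the
    inverse of an injection.\<close>
  let ?S = "pullback_topology (f ` ?X) ?g T"
  have gX: "?g ` (f ` ?X) = ?X" using f by (simp add: image_inv_into_cancel)
  have ts: "topspace ?S = f ` ?X"
    unfolding topspace_pullback_topology using gX by blast
  have "continuous_map ?S T ?g"
    unfolding continuous_map_def ts openin_pullback_topology using gX by blast
  moreover have "continuous_map T ?S f"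
    unfolding continuous_map_def ts openin_pullback_topology
  proof (intro conjI allI impI)
    show "f \<in> ?X \<rightarrow> f ` ?X" by auto
    fix U assume "\<exists>V. openin T V \<and> U = ?g -` V \<inter> f ` ?X"
    then obtain V where V: "openin T V" "U = ?g -` V \<inter> f ` ?X" by blast
    have "{x \<in> ?X. f x \<in> U} = V" using f openin_subset[OF V(1)] unfolding V(2) by auto (metis in_mono inj_onD)
    then show "openin T {x \<in> ?X. f x \<in> U}" using V by simp
  qed
  ultimately have "homeomorphic_maps ?S T ?g f"
    using f by (auto simp: homeomorphic_maps_def ts f_inv_into_f)
  then show ?thesis unfolding homeomorphic_space_def by blast
qed

lemma homeomorphic_space_finite:
  "S homeomorphic_space T \<Longrightarrow> finite (topspace S) \<Longrightarrow> finite (topspace T)"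
  unfolding homeomorphic_space by (metis finite_imageI homeomorphic_imp_surjective_map)

lemma homeomorphic_space_card:
  "S homeomorphic_space T \<Longrightarrow> card (topspace S) = card (topspace T)"
  unfolding homeomorphic_space
  by (metis card_image homeomorphic_imp_injective_map homeomorphic_imp_surjective_map)

lemma finite_rep_ftop_class: "finite (topspace (rep_ftop_class C))"
  using Quotient3_rep_reflp[OF Quotient3_ftop_class, of C] by simp

lemma some_homeomorphic:
  assumes "finite (topspace T)"
  defines "S \<equiv> (SOME S :: nat topology. S homeomorphic_space T)"
  shows "S homeomorphic_space T" "finite (topspace S)"
proof -
  show 1: "S homeomorphic_space T"
    unfolding S_def by (rule someI_ex[OF ex_nat_homeomorphic[OF assms(1)]])
  show "finite (topspace S)"
    using homeomorphic_space_finite[OF _ assms(1)] 1 homeomorphic_space_sym by blast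
qed

lemma rep_homeo_class:
  assumes "finite (topspace T)"
  shows "rep_ftop_class (homeo_class T) homeomorphic_space T"
proof -
  let ?S = "SOME S :: nat topology. S homeomorphic_space T"
  have "rep_ftop_class (abs_ftop_class ?S) homeomorphic_space ?S"
    using Quotient3_rep_abs[OF Quotient3_ftop_class, of ?S] some_homeomorphic[OF assms]
    by (auto simp: homeomorphic_space_refl)
  then show ?thesis
    unfolding homeo_class_def using some_homeomorphic(1)[OF assms] homeomorphic_space_trans by blast
qed

lemma homeo_class_eqI:
  assumes "finite (topspace S)" "S homeomorphic_space T"
  shows "homeo_class S = homeo_class T"
proof -
  have T: "finite (topspace T)" using homeomorphic_space_finite assms by blast
  show ?thesis unfolding homeo_class_def
    by (rule Quotient3_rel_abs[OF Quotient3_ftop_class])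
       (metis some_homeomorphic assms T homeomorphic_space_sym homeomorphic_space_trans)
qed

lemma homeo_class_rep: "homeo_class (rep_ftop_class C) = C"
proof -
  let ?T = "rep_ftop_class C"
  have "homeo_class ?T = abs_ftop_class ?T"
    unfolding homeo_class_def
    by (rule Quotient3_rel_abs[OF Quotient3_ftop_class])
       (use some_homeomorphic[OF finite_rep_ftop_class[of C]] in auto)
  then show ?thesis by (simp add: Quotient3_abs_rep[OF Quotient3_ftop_class])
qed

lemma homeo_class_empty: "topspace T = {} \<Longrightarrow> homeo_class T = empty_class"
  unfolding empty_class_def by (rule homeo_class_eqI) (auto simp: homeomorphic_empty_space_eq)

lemma lamT_rep_homeo_class:
  "finite (topspace T) \<Longrightarrow> lamT (rep_ftop_class (homeo_class T)) = lamT T"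
  by (rule lamT_homeomorphic[OF rep_homeo_class])

section \<open>Products and quasi-shuffles\<close>

lemma lin_mult_QSym_left: "lin (\<lambda>x. mult QSym_alg x y)"
  by (simp add: QSym_alg_def lin_bilin_ext_left)

lemma lin_mult_QSym_right: "lin (mult QSym_alg x)"
  by (simp add: QSym_alg_def lin_bilin_ext_right)

lemma mult_QSym_sum_left: "mult QSym_alg (sum f A) y = (\<Sum>a\<in>A. mult QSym_alg (f a) y)"
  by (rule lin_sum[OF lin_mult_QSym_left])

lemma mult_QSym_sum_right: "mult QSym_alg x (sum f A) = (\<Sum>a\<in>A. mult QSym_alg x (f a))"
  by (rule lin_sum[OF lin_mult_QSym_right])

lemma mult_QSym_M:
  assumes "\<forall>i\<in>set c. 0 < i" "\<forall>i\<in>set d. 0 < i"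
  shows "mult QSym_alg (M c) (M d) = qsym_prod c d"
  using assms by (simp add: QSym_alg_def M_def Abs_composition_inverse)

lemma finite_QSh: "finite (QSh k l)"
proof (rule finite_subset)
  show "QSh k l \<subseteq> {..<k + l} \<rightarrow>\<^sub>E {..k + l}"
  proof
    fix u assume u: "u \<in> QSh k l"
    then obtain m where m: "u ` {..<k + l} = {..<m}" by (auto simp: QSh_def)
    have "m \<le> k + l" using card_image_le[of "{..<k + l}" u] m by simp
    moreover have "u x < m" if "x \<in> {..<k + l}" for x using m that by blast
    ultimately have "u x \<le> k + l" if "x \<in> {..<k + l}" for x using that by fastforce
    then show "u \<in> {..<k + l} \<rightarrow>\<^sub>E {..k + l}" using u by (auto simp: QSh_def PiE_def)
  qed
qed (auto intro: finite_PiE)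

text \<open>When \<open>f\<close> maps \<open>A\<close> onto \<open>{..<k}\<close>, this is the
  index of the block of a point in \<open>fibers A f @ fibers B g\<close>. These are the indices on
  which a quasi-shuffle acts.\<close>

definition glue :: "'a set \<Rightarrow> 'a set \<Rightarrow> nat \<Rightarrow> ('a \<Rightarrow> nat) \<Rightarrow> ('a \<Rightarrow> nat) \<Rightarrow> 'a \<Rightarrow> nat" where
  "glue A B k f g = (\<lambda>x\<in>A \<union> B. if x \<in> A then f x else k + g x)"

lemma image_glue:
  assumes "A \<inter> B = {}" "f ` A = {..<k}" "g ` B = {..<l}"
  shows "glue A B k f g ` (A \<union> B) = {..<k + l}"
proof -
  have "glue A B k f g ` A = f ` A" by (auto simp: glue_def image_iff)
  moreover have "glue A B k f g ` B = (+) k ` (g ` B)"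
    unfolding image_image using assms(1) by (intro image_cong) (auto simp: glue_def)
  moreover have "(+) k ` {..<l} = {k..<k + l}"
    by (simp add: lessThan_atLeast0 add.commute)
  ultimately show ?thesis using assms(2,3) by (auto simp: image_Un)
qed

lemma fibers_glue:
  assumes "A \<inter> B = {}" "f ` A = {..<k}" "g ` B = {..<l}" "i < k + l"
  shows "(fibers A f @ fibers B g) ! i = {x \<in> A \<union> B. glue A B k f g x = i}"
proof -
  have f: "f x < k" if "x \<in> A" for x using that assms(2) by blast
  show ?thesis
  proof (cases "i < k")
    case True
    then show ?thesis using assms(1-3) by (auto simp: fibers_def nth_append glue_def)
  next
    case False
    then have "i - k < l" using assms(4) by simp
    with False show ?thesis using assms(1-3) f by (fastforce simp: fibers_def nth_append glue_def)
  qed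
qed

text \<open>Entry \<open>j\<close> of the merged composition adds the sizes of the blocks that
  \<open>u\<close> sends to \<open>j\<close>, and these blocks partition the fiber of
  \<open>h\<close> over \<open>j\<close>.\<close>

lemma qsh_merge_fibers:
  assumes "finite A" "finite B" and dj: "A \<inter> B = {}" and fA: "f ` A = {..<k}" and gB: "g ` B = {..<l}"
    and h: "\<And>x. x \<in> A \<union> B \<Longrightarrow> h x = u (glue A B k f g x)"
  shows "qsh_merge (map card (fibers A f) @ map card (fibers B g)) u = map card (fibers (A \<union> B) h)"
proof -
  let ?X = "A \<union> B"
  let ?p = "glue A B k f g"
  let ?w = "map card (fibers A f) @ map card (fibers B g)"
  have fin: "finite ?X" using assms by simp
  have len: "length ?w = k + l" using fA gB by (simp add: fibers_def)
  have w: "?w ! i = card {x \<in> ?X. ?p x = i}" if "i < k + l" for i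
  proof -
    have "?w ! i = map card (fibers A f @ fibers B g) ! i" by simp
    also have "\<dots> = card ((fibers A f @ fibers B g) ! i)"
      using that len by (subst nth_map) auto
    finally show ?thesis using fibers_glue[OF dj fA gB that] by simp
  qed
  have im: "h ` ?X = u ` {..<k + l}"
    unfolding image_glue[OF dj fA gB, symmetric] image_image using h by (intro image_cong) auto
  have px: "?p x < k + l" if "x \<in> ?X" for x using image_glue[OF dj fA gB] that by blast
  have "(\<Sum>i | i < k + l \<and> u i = j. ?w ! i) = card {x \<in> ?X. h x = j}" for j
  proof -
    have "(\<Sum>i | i < k + l \<and> u i = j. ?w ! i)
        = (\<Sum>i | i < k + l \<and> u i = j. card {x \<in> {x \<in> ?X. h x = j}. ?p x = i})"
    proof (rule sum.cong[OF refl])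
      fix i assume i: "i \<in> {i. i < k + l \<and> u i = j}"
      then have "{x \<in> ?X. ?p x = i} = {x \<in> {x \<in> ?X. h x = j}. ?p x = i}"
        using h by auto
      then show "?w ! i = card {x \<in> {x \<in> ?X. h x = j}. ?p x = i}" using w[of i] i by simp
    qed
    also have "\<dots> = (\<Sum>i | i < k + l \<and> u i = j. \<Sum>x | x \<in> {x \<in> ?X. h x = j} \<and> ?p x = i. 1)"
      by simp
    also have "\<dots> = (\<Sum>x\<in>{x \<in> ?X. h x = j}. 1)"
      by (rule sum.group) (use fin px h in auto)
    finally show ?thesis by simp
  qed
  then show ?thesis
    unfolding qsh_merge_def len by (simp add: fibers_def im comp_def)
qed

lemma top_less_subtopology:
  "x \<in> Y \<Longrightarrow> y \<in> Y \<Longrightarrow> top_less (subtopology T Y) x y \<longleftrightarrow> top_less T x y"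
  by (simp add: top_less_def top_le_subtopology)

lemma top_sim_subtopology:
  "x \<in> Y \<Longrightarrow> y \<in> Y \<Longrightarrow> top_sim (subtopology T Y) x y \<longleftrightarrow> top_sim T x y"
  by (simp add: top_sim_def top_le_subtopology)

lemma packed_mapsD:
  assumes "f \<in> packed_maps S"
  shows "f \<in> extensional (topspace S)" "f ` topspace S = {..<card (f ` topspace S)}"
proof -
  obtain m where "f ` topspace S = {..<m}" using assms by (auto simp: packed_maps_def)
  then show "f ` topspace S = {..<card (f ` topspace S)}" by simp
qed (use assms in \<open>auto simp: packed_maps_def lin_maps_def PiE_def\<close>)

text \<open>Two mutually incomparable parts of one space. This covers the disjoint union of two
  spaces and also a block split off from a block topology, where the points stay the same.\<close>

locale split_space =
  fixes T :: "'a topology" and A B :: "'a set"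
  assumes fin: "finite (topspace T)"
    and un: "topspace T = A \<union> B" and dj: "A \<inter> B = {}"
    and inc: "\<And>x y. x \<in> A \<Longrightarrow> y \<in> B \<Longrightarrow> \<not> top_le T x y \<and> \<not> top_le T y x"
begin

abbreviation "TA \<equiv> subtopology T A"
abbreviation "TB \<equiv> subtopology T B"

lemma tsA: "topspace TA = A" and tsB: "topspace TB = B"
  using un by auto

text \<open>Incomparability makes the conditions on a point of \<open>A\<close> and a point of
  \<open>B\<close> vacuous.\<close>

lemma lin_maps_iff:
  "h \<in> lin_maps UNIV T \<longleftrightarrow> h \<in> extensional (A \<union> B) \<and> restrict h A \<in> lin_maps UNIV TA \<and> restrict h B \<in> lin_maps UNIV TB"
proof -
  let ?P = "\<lambda>x y. (top_less T x y \<longrightarrow> h x < h y) \<and> (top_sim T x y \<longrightarrow> h x = h y)"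
  have "?P x y" "?P y x" if "x \<in> A" "y \<in> B" for x y
    using inc[OF that] unfolding top_less_def top_sim_def by blast+
  then have "(\<forall>x\<in>A \<union> B. \<forall>y\<in>A \<union> B. ?P x y) \<longleftrightarrow> (\<forall>x\<in>A. \<forall>y\<in>A. ?P x y) \<and> (\<forall>x\<in>B. \<forall>y\<in>B. ?P x y)"
    by blast
  then show ?thesis
    unfolding lin_maps_def un tsA tsB
    by (simp add: PiE_def top_less_subtopology top_sim_subtopology)
qed

text \<open>Strict monotonicity of \<open>u\<close> on its two ranges says that \<open>?zs\<close>
  and \<open>?ws\<close> are increasing, and \<open>h\<close> reads its values on \<open>A\<close>
  and \<open>B\<close> from them along \<open>f\<close> and \<open>g\<close>. So the factorization
  lemma applies to each part, while the image of \<open>u\<close> is that of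
  \<open>h\<close>.\<close>

lemma packed_glue:
  assumes f: "f \<in> extensional A" "f ` A = {..<k}" and g: "g \<in> extensional B" "g ` B = {..<l}"
    and u: "u \<in> QSh k l"
    and h: "h = (\<lambda>x\<in>A \<union> B. u (glue A B k f g x))"
  shows "h \<in> packed_maps T \<longleftrightarrow> f \<in> packed_maps TA \<and> g \<in> packed_maps TB"
proof -
  have im: "h ` (A \<union> B) = u ` {..<k + l}"
    unfolding image_glue[OF dj f(2) g(2), symmetric] image_image h by (intro image_cong) auto
  have sm: "strict_mono_on {..<k} u" "strict_mono_on {k..<k + l} u" using u by (auto simp: QSh_def)
  let ?zs = "map u [0..<k]" and ?ws = "map (\<lambda>i. u (k + i)) [0..<l]"
  have zs: "sorted_wrt (<) ?zs" using sm(1) by (auto simp: sorted_wrt_iff_nth_less strict_mono_on_def)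
  have ws: "sorted_wrt (<) ?ws" using sm(2) by (auto simp: sorted_wrt_iff_nth_less strict_mono_on_def)
  have fk: "f x < k" if "x \<in> A" for x using f(2) that by blast
  have gl: "g x < l" if "x \<in> B" for x using g(2) that by blast
  have "restrict h A \<in> lin_maps UNIV TA \<longleftrightarrow> f \<in> packed_maps TA \<and> set ?zs \<subseteq> UNIV"
    by (rule lin_maps_factorization[where T = TA, unfolded tsA, OF _ _ zs]) (use f fk in \<open>auto simp: h glue_def\<close>)
  moreover have "restrict h B \<in> lin_maps UNIV TB \<longleftrightarrow> g \<in> packed_maps TB \<and> set ?ws \<subseteq> UNIV"
    by (rule lin_maps_factorization[where T = TB, unfolded tsB, OF _ _ ws]) (use g gl dj in \<open>auto simp: h glue_def\<close>)
  moreover have "h \<in> extensional (A \<union> B)" by (simp add: h)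
  moreover have "\<exists>m. h ` (A \<union> B) = {..<m}" using u im by (auto simp: QSh_def)
  ultimately show ?thesis unfolding packed_maps_def[of T] lin_maps_iff un by auto
qed

abbreviation "D \<equiv> (SIGMA f:packed_maps TA. SIGMA g:packed_maps TB. QSh (card (f ` A)) (card (g ` B)))"

definition Phi :: "('a \<Rightarrow> nat) \<times> ('a \<Rightarrow> nat) \<times> (nat \<Rightarrow> nat) \<Rightarrow> 'a \<Rightarrow> nat" where
  "Phi = (\<lambda>(f, g, u). \<lambda>x\<in>A \<union> B. u (glue A B (card (f ` A)) f g x))"

text \<open>A packed map of the whole space need not restrict to packed maps: its values on one part
  can have gaps. Ranking the values on each part closes the gaps, and the quasi-shuffle records
  where the ranks came from.\<close>

lemma bij_betw_Phi: "bij_betw Phi D (packed_maps T)"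
  unfolding bij_betw_def
proof
  show "inj_on Phi D"
  proof (rule inj_onI)
    fix p q assume "p \<in> D" "q \<in> D" and eq: "Phi p = Phi q"
    then obtain f g u f' g' u' where p: "p = (f, g, u)" and q: "q = (f', g', u')"
      and f: "f \<in> packed_maps TA" "f' \<in> packed_maps TA" and g: "g \<in> packed_maps TB" "g' \<in> packed_maps TB"
      and u: "u \<in> QSh (card (f ` A)) (card (g ` B))" "u' \<in> QSh (card (f' ` A)) (card (g' ` B))"
      by auto
    define h where "h = Phi p"
    note F = packed_mapsD[OF f(1), unfolded tsA] packed_mapsD[OF f(2), unfolded tsA]
    note G = packed_mapsD[OF g(1), unfolded tsB] packed_mapsD[OF g(2), unfolded tsB]
    have sm: "strict_mono_on {..<card (f ` A)} u" "strict_mono_on {card (f ` A)..<card (f ` A) + card (g ` B)} u"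
      "strict_mono_on {..<card (f' ` A)} u'" "strict_mono_on {card (f' ` A)..<card (f' ` A) + card (g' ` B)} u'"
      using u by (auto simp: QSh_def)
    have fk: "f x < card (f ` A)" "f' x < card (f' ` A)" if "x \<in> A" for x using F(2,4) that by blast+
    have gl: "g x < card (g ` B)" "g' x < card (g' ` B)" if "x \<in> B" for x using G(2,4) that by blast+
    have zs: "sorted_wrt (<) (map u [0..<card (f ` A)])" "sorted_wrt (<) (map u' [0..<card (f' ` A)])"
      using sm by (auto simp: sorted_wrt_iff_nth_less strict_mono_on_def)
    have ws: "sorted_wrt (<) (map (\<lambda>i. u (card (f ` A) + i)) [0..<card (g ` B)])"
      "sorted_wrt (<) (map (\<lambda>i. u' (card (f' ` A) + i)) [0..<card (g' ` B)])"
      using sm by (auto simp: sorted_wrt_iff_nth_less strict_mono_on_def)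
    have h': "h = Phi (f', g', u')" using eq q by (simp add: h_def)
    have hA: "h x = u (f x)" "h x = u' (f' x)" if "x \<in> A" for x
      using that by (simp add: h_def p Phi_def glue_def, simp add: h' Phi_def glue_def)
    have hB: "h x = u (card (f ` A) + g x)" "h x = u' (card (f' ` A) + g' x)" if "x \<in> B" for x
    proof -
      have "x \<notin> A" using that dj by blast
      then show "h x = u (card (f ` A) + g x)" "h x = u' (card (f' ` A) + g' x)"
        using that by (simp add: h_def p Phi_def glue_def, simp add: h' Phi_def glue_def)
    qed
    \<comment> \<open>Both triples factor the same \<open>h\<close> on \<open>A\<close>, so
      uniqueness identifies the packed maps and the lower parts of \<open>u\<close> and
      \<open>u'\<close> at once.\<close>
    have 1: "f = f' \<and> map u [0..<card (f ` A)] = map u' [0..<card (f' ` A)]"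
      by (rule rank_factorization_unique[OF F(1) _ zs(1) _ F(3) _ zs(2), of h])
         (use F hA fk in simp_all)
    have 2: "g = g' \<and> map (\<lambda>i. u (card (f ` A) + i)) [0..<card (g ` B)]
        = map (\<lambda>i. u' (card (f' ` A) + i)) [0..<card (g' ` B)]"
      by (rule rank_factorization_unique[OF G(1) _ ws(1) _ G(3) _ ws(2), of h])
         (use G hB gl in simp_all)
    have "u = u'"
    proof (rule extensionalityI[of _ "{..<card (f ` A) + card (g ` B)}"])
      fix i assume i: "i \<in> {..<card (f ` A) + card (g ` B)}"
      show "u i = u' i"
      proof (cases "i < card (f ` A)")
        case True
        have "map u [0..<card (f ` A)] ! i = map u' [0..<card (f ` A)] ! i" using 1 by metis
        with True show ?thesis by simp
      next
        case False
        then obtain j where j: "i = card (f ` A) + j" "j < card (g ` B)"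
          using i by (metis add_less_cancel_left lessThan_iff le_iff_add not_less)
        have "map (\<lambda>i. u (card (f ` A) + i)) [0..<card (g ` B)] ! j
            = map (\<lambda>i. u' (card (f ` A) + i)) [0..<card (g ` B)] ! j" using 1 2 by metis
        with j show ?thesis by simp
      qed
    qed (use u 1 2 in \<open>auto simp: QSh_def\<close>)
    then show "p = q" using 1 2 p q by simp
  qed
  show "Phi ` D = packed_maps T"
  proof
    show "Phi ` D \<subseteq> packed_maps T"
    proof
      fix h assume "h \<in> Phi ` D"
      then obtain f g u where h: "h = Phi (f, g, u)" and f: "f \<in> packed_maps TA"
        and g: "g \<in> packed_maps TB" and u: "u \<in> QSh (card (f ` A)) (card (g ` B))" by auto
      have h': "h = (\<lambda>x\<in>A \<union> B. u (glue A B (card (f ` A)) f g x))" unfolding h by (simp add: Phi_def)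
      show "h \<in> packed_maps T"
        using packed_glue[OF packed_mapsD[OF f, unfolded tsA] packed_mapsD[OF g, unfolded tsB] u h'] f g
        by simp
    qed
    show "packed_maps T \<subseteq> Phi ` D"
    proof
      fix h assume h: "h \<in> packed_maps T"
      have fins: "finite A" "finite B" using fin un by auto
      obtain f zs where f: "f \<in> extensional A" "f ` A = {..<length zs}" "sorted_wrt (<) zs" "\<forall>x\<in>A. h x = zs ! f x"
        using rank_factorization_ex[OF fins(1), of h] by blast
      obtain g ws where g: "g \<in> extensional B" "g ` B = {..<length ws}" "sorted_wrt (<) ws" "\<forall>x\<in>B. h x = ws ! g x"
        using rank_factorization_ex[OF fins(2), of h] by blast
      have k: "card (f ` A) = length zs" and l: "card (g ` B) = length ws" using f(2) g(2) by simp_all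
      let ?n = "length zs + length ws"
      \<comment> \<open>The values on \<open>A\<close> come first and those on \<open>B\<close>
        after them, in agreement with the shift by \<open>length zs\<close> in
        \<open>glue\<close>.\<close>
      define u where "u = (\<lambda>i\<in>{..<?n}. (zs @ ws) ! i)"
      have fk: "f x < length zs" if "x \<in> A" for x using f(2) that by blast
      have gl: "g x < length ws" if "x \<in> B" for x using g(2) that by blast
      have hu: "h x = u (glue A B (length zs) f g x)" if "x \<in> A \<union> B" for x
        using that f(4) g(4) fk[of x] gl[of x] dj by (auto simp: u_def glue_def nth_append)
      have "h \<in> extensional (A \<union> B)" using packed_mapsD(1)[OF h] un by simp
      then have h': "h = (\<lambda>x\<in>A \<union> B. u (glue A B (length zs) f g x))"
        by (rule extensionalityI) (use hu in auto)
      have "h ` (A \<union> B) = u ` {..<?n}"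
        unfolding image_glue[OF dj f(2) g(2), symmetric] image_image using hu by (intro image_cong) auto
      moreover have "h ` (A \<union> B) = {..<card (h ` (A \<union> B))}" using packed_mapsD(2)[OF h] un by simp
      ultimately have "\<exists>m. u ` {..<?n} = {..<m}" by metis
      moreover have "strict_mono_on {..<length zs} u"
        using sorted_wrt_nth_less[OF f(3)] by (auto simp: strict_mono_on_def u_def nth_append)
      moreover have "strict_mono_on {length zs..<?n} u"
        using sorted_wrt_nth_less[OF g(3)] by (auto simp: strict_mono_on_def u_def nth_append)
      ultimately have u: "u \<in> QSh (length zs) (length ws)"
        by (simp add: QSh_def u_def)
      have "f \<in> packed_maps TA" "g \<in> packed_maps TB"
        using packed_glue[OF f(1,2) g(1,2) u h'] h by auto
      then have "(f, g, u) \<in> D" using u k l by simp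
      moreover have "h = Phi (f, g, u)" using h' by (simp add: Phi_def k)
      ultimately show "h \<in> Phi ` D" by blast
    qed
  qed
qed

lemma lamT_split: "lamT T = mult QSym_alg (lamT TA) (lamT TB)"
proof -
  have fins: "finite A" "finite B" using fin un by auto
  have finP: "finite (packed_maps TA)" "finite (packed_maps TB)"
    by (rule finite_packed_maps, use fins tsA tsB in simp)+
  have pos: "\<forall>i\<in>set (map card (fibers A f)). 0 < i" if "f \<in> packed_maps TA" for f
    using card_lin_set_composition_pos[of TA, OF _ fibers_in_lin_set_compositions[OF that]] fins tsA by simp
  have pos': "\<forall>i\<in>set (map card (fibers B f)). 0 < i" if "f \<in> packed_maps TB" for f
    using card_lin_set_composition_pos[of TB, OF _ fibers_in_lin_set_compositions[OF that]] fins tsB by simp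
  have "mult QSym_alg (lamT TA) (lamT TB)
      = (\<Sum>f\<in>packed_maps TA. \<Sum>g\<in>packed_maps TB. mult QSym_alg (M (map card (fibers A f))) (M (map card (fibers B g))))"
    unfolding lamT_packed tsA tsB mult_QSym_sum_left by (simp only: mult_QSym_sum_right)
  also have "\<dots> = (\<Sum>f\<in>packed_maps TA. \<Sum>g\<in>packed_maps TB. \<Sum>u\<in>QSh (card (f ` A)) (card (g ` B)).
      M (map card (fibers (A \<union> B) (Phi (f, g, u)))))"
  proof (intro sum.cong refl)
    fix f g assume f: "f \<in> packed_maps TA" and g: "g \<in> packed_maps TB"
    have len: "length (map card (fibers A f)) = card (f ` A)" "length (map card (fibers B g)) = card (g ` B)"
      by (simp_all add: fibers_def)
    show "mult QSym_alg (M (map card (fibers A f))) (M (map card (fibers B g)))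
       = (\<Sum>u\<in>QSh (card (f ` A)) (card (g ` B)). M (map card (fibers (A \<union> B) (Phi (f, g, u)))))"
      unfolding mult_QSym_M[OF pos[OF f] pos'[OF g]] qsym_prod_def len
    proof (intro sum.cong refl arg_cong[where f = M] qsh_merge_fibers fins dj)
      show "f ` A = {..<card (f ` A)}" using packed_mapsD(2)[OF f] tsA by simp
      show "g ` B = {..<card (g ` B)}" using packed_mapsD(2)[OF g] tsB by simp
    qed (simp add: Phi_def)
  qed
  also have "\<dots> = (\<Sum>(f, g, u)\<in>D. M (map card (fibers (A \<union> B) (Phi (f, g, u)))))"
    using finP by (simp add: sum.Sigma finite_QSh)
  also have "\<dots> = (\<Sum>p\<in>D. M (map card (fibers (A \<union> B) (Phi p))))"
    by (simp add: case_prod_unfold)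
  also have "\<dots> = (\<Sum>h\<in>packed_maps T. M (map card (fibers (A \<union> B) h)))"
    by (rule sum.reindex_bij_betw[OF bij_betw_Phi])
  also have "\<dots> = lamT T" unfolding lamT_packed un ..
  finally show ?thesis by (rule sym)
qed

end

section \<open>Disjoint unions and the unit\<close>

lemma lamT_disj_union_top:
  fixes S T :: "'a topology"
  assumes "finite (topspace S)" "finite (topspace T)"
  shows "lamT (disj_union_top S T) = mult QSym_alg (lamT S) (lamT T)"
proof -
  let ?U = "disj_union_top S T"
  let ?A = "Pair False ` topspace S" and ?B = "Pair True ` topspace T"
  let ?X = "\<lambda>i. if i then T else S"
  have ts: "topspace ?U = ?A \<union> ?B"
    by (auto simp: disj_union_top_def split: if_splits)
  have emb: "embedding_map (?X i) ?U (Pair i)" for i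
    unfolding disj_union_top_def by (rule embedding_map_component_injection) simp
  have A: "S homeomorphic_space subtopology ?U ?A" and B: "T homeomorphic_space subtopology ?U ?B"
    using emb[of False] emb[of True] unfolding embedding_map_def homeomorphic_space by auto
  have op: "open_map (?X i) ?U (Pair i)" for i
    unfolding disj_union_top_def by (rule open_map_component_injection) simp
  have oA: "openin ?U ?A" and oB: "openin ?U ?B"
    using op[of False] op[of True] by (auto simp: open_map_def)
  interpret split_space ?U ?A ?B
  proof
    show "finite (topspace ?U)" using ts assms by simp
    \<comment> \<open>Both summands are open, and a relation cannot lead out of an open set.\<close>
    show "\<not> top_le ?U x y \<and> \<not> top_le ?U y x" if "x \<in> ?A" "y \<in> ?B" for x y
    proof -
      have "x \<notin> ?B" "y \<notin> ?A" using that by auto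
      then show ?thesis using that oA oB unfolding top_le_def by blast
    qed
  qed (use ts in auto)
  show ?thesis
    unfolding lamT_homeomorphic[OF A] lamT_homeomorphic[OF B] by (rule lamT_split)
qed

lemma qsym_prod_Nil:
  "\<forall>i\<in>set c. 0 < i \<Longrightarrow> qsym_prod c [] = M c"
proof -
  let ?k = "length c"
  let ?e = "\<lambda>i\<in>{..<?k}. i"
  have "u = ?e" if u: "u \<in> QSh ?k 0" for u
  proof -
    obtain m where m: "u ` {..<?k} = {..<m}" using u by (auto simp: QSh_def)
    have sm: "strict_mono_on {..<?k} u" and ue: "u \<in> extensional {..<?k}" using u by (auto simp: QSh_def)
    \<comment> \<open>The map \<open>u\<close> has two rank factorizations: the identity followed by
      the list of its values, and \<open>u\<close> itself followed by \<open>[0..<m]\<close>.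
      Uniqueness leaves the identity as the only quasi-shuffle with an empty second range.\<close>
    have "?e = u \<and> map u [0..<?k] = [0..<m]"
    proof (rule rank_factorization_unique[of _ "{..<?k}" _ u])
      show "sorted_wrt (<) (map u [0..<?k])"
        using sm by (auto simp: sorted_wrt_iff_nth_less strict_mono_on_def)
      have "u x < m" if "x \<in> {..<?k}" for x using m that by blast
      then show "\<forall>x\<in>{..<?k}. u x = [0..<m] ! u x" by simp
    qed (use m ue in auto)
    then show ?thesis by simp
  qed
  moreover have "?e \<in> QSh ?k 0" by (auto simp: QSh_def strict_mono_on_def)
  ultimately have "QSh ?k 0 = {?e}" by blast
  moreover have "qsh_merge c ?e = c"
  proof (rule nth_equalityI)
    have im: "?e ` {..<?k} = {..<?k}" by auto
    then show "length (qsh_merge c ?e) = ?k" by (simp add: qsh_merge_def)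
    fix j assume "j < length (qsh_merge c ?e)"
    then have j: "j < ?k" using im by (simp add: qsh_merge_def)
    then have "{i. i < ?k \<and> ?e i = j} = {j}" by auto
    then show "qsh_merge c ?e ! j = c ! j" using im j by (simp add: qsh_merge_def)
  qed
  ultimately show ?thesis by (simp add: qsym_prod_def)
qed

lemma mult_QSym_one_right: "mult QSym_alg x (M []) = x"
proof (rule lin_eqI[OF lin_mult_QSym_left lin_ident])
  fix c
  have "bas c = M (Rep_composition c)" by (simp add: M_def Rep_composition_inverse)
  moreover have "mult QSym_alg (M (Rep_composition c)) (M []) = M (Rep_composition c)"
    using Rep_composition[of c] by (simp add: mult_QSym_M qsym_prod_Nil)
  ultimately show "mult QSym_alg (bas c) (M []) = bas c" by metis
qed

section \<open>Coproducts\<close>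

text \<open>Restriction does not change the relations between points of \<open>Y\<close>, so the
  pieces of a list can all be described by the order of \<open>T\<close> itself.\<close>

lemma lin_set_compositions_subtopology_iff:
  assumes "Y \<subseteq> topspace T"
  shows "Xs \<in> lin_set_compositions (subtopology T Y) \<longleftrightarrow>
    {} \<notin> set Xs \<and> \<Union>(set Xs) = Y \<and> sorted_wrt (below T) Xs \<and> (\<forall>A\<in>set Xs. flat T A)"
proof -
  have ts: "topspace (subtopology T Y) = Y" using assms by auto
  have b: "below (subtopology T Y) A B \<longleftrightarrow> below T A B" if "A \<subseteq> Y" "B \<subseteq> Y" for A B
    using that by (auto simp: below_def top_le_subtopology)
  have f: "flat (subtopology T Y) A \<longleftrightarrow> flat T A" if "A \<subseteq> Y" for A
    using that unfolding flat_def top_le_subtopology by blast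
  have "sorted_wrt (below (subtopology T Y)) Xs \<longleftrightarrow> sorted_wrt (below T) Xs" if un: "\<Union>(set Xs) = Y"
  proof -
    have bb: "below (subtopology T Y) A B \<longleftrightarrow> below T A B" if "A \<in> set Xs" "B \<in> set Xs" for A B
      by (rule b) (use that un in auto)
    show ?thesis using bb sorted_wrt_mono_rel[of Xs "below T" "below (subtopology T Y)"]
        sorted_wrt_mono_rel[of Xs "below (subtopology T Y)" "below T"] by blast
  qed
  moreover have "(\<forall>A\<in>set Xs. flat (subtopology T Y) A) \<longleftrightarrow> (\<forall>A\<in>set Xs. flat T A)" if un: "\<Union>(set Xs) = Y"
    using f un by blast
  ultimately show ?thesis unfolding lin_set_compositions_iff ts by blast
qed

text \<open>That no relation leads from the tail back to the head says exactly that the union of the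
  tail is upwards closed. The tail is the open part, in agreement with the second tensor factor of
  \<open>top_coprod\<close>.\<close>

lemma append_in_lin_set_compositions:
  assumes fin: "finite (topspace T)"
  shows "Us @ Vs \<in> lin_set_compositions T \<longleftrightarrow>
    openin T (\<Union>(set Vs)) \<and> Us \<in> lin_set_compositions (subtopology T (topspace T - \<Union>(set Vs))) \<and>
    Vs \<in> lin_set_compositions (subtopology T (\<Union>(set Vs)))" (is "?L \<longleftrightarrow> ?R")
proof
  assume L: ?L
  have un: "\<Union>(set Us) \<union> \<Union>(set Vs) = topspace T"
    and cross: "\<And>A B x y. A \<in> set Us \<Longrightarrow> B \<in> set Vs \<Longrightarrow> x \<in> A \<Longrightarrow> y \<in> B \<Longrightarrow> \<not> top_le T y x"
    using L by (auto simp: lin_set_compositions_iff sorted_wrt_append below_def)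
  have "\<Union>(set Us) \<inter> \<Union>(set Vs) = {}"
  proof (rule ccontr)
    assume "\<Union>(set Us) \<inter> \<Union>(set Vs) \<noteq> {}"
    then obtain x A B where x: "A \<in> set Us" "B \<in> set Vs" "x \<in> A" "x \<in> B" by blast
    then have "x \<in> topspace T" using un by blast
    then show False using cross[OF x] top_le_refl[of x T] by simp
  qed
  then have Us: "\<Union>(set Us) = topspace T - \<Union>(set Vs)" using un by blast
  have "openin T (\<Union>(set Vs))"
    unfolding openin_iff_top_le[OF fin]
  proof (intro conjI ballI allI impI)
    show "\<Union>(set Vs) \<subseteq> topspace T" using un by blast
    fix x y assume x: "x \<in> \<Union>(set Vs)" and le: "top_le T x y"
    have "y \<notin> \<Union>(set Us)" using cross x le by blast
    then show "y \<in> \<Union>(set Vs)" using un top_leD[OF le] by blast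
  qed
  moreover have "\<Union>(set Vs) \<subseteq> topspace T" using un by blast
  ultimately show ?R
    using L Us unfolding lin_set_compositions_subtopology_iff[OF Diff_subset]
      lin_set_compositions_subtopology_iff[OF \<open>\<Union>(set Vs) \<subseteq> topspace T\<close>]
      lin_set_compositions_iff[of _ T] sorted_wrt_append by simp
next
  assume R: ?R
  then have op: "openin T (\<Union>(set Vs))" by blast
  then have sub: "\<Union>(set Vs) \<subseteq> topspace T" by (rule openin_subset)
  have Us: "Us \<in> lin_set_compositions (subtopology T (topspace T - \<Union>(set Vs)))"
    and Vs: "Vs \<in> lin_set_compositions (subtopology T (\<Union>(set Vs)))" using R by auto
  note Us' = Us[unfolded lin_set_compositions_subtopology_iff[OF Diff_subset]]
  note Vs' = Vs[unfolded lin_set_compositions_subtopology_iff[OF sub]]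
  have cross: "below T A B" if "A \<in> set Us" "B \<in> set Vs" for A B
  proof -
    have "A \<inter> \<Union>(set Vs) = {}" using Us' that by blast
    then show ?thesis using op that unfolding below_def top_le_def by blast
  qed
  show ?L unfolding lin_set_compositions_iff sorted_wrt_append using Us' Vs' cross sub by auto
qed

lemma comult_QSym_M:
  "\<forall>i\<in>set c. 0 < i \<Longrightarrow> comult QSym_alg (M c) = qsym_coprod c"
  by (simp add: QSym_alg_def M_def Abs_composition_inverse)

lemma lin_comult_QSym: "lin (comult QSym_alg)"
  by (simp add: QSym_alg_def lin_lin_ext)

lemma finite_openin: "finite (topspace T) \<Longrightarrow> finite {Y. openin T Y}"
  by (rule finite_subset[of _ "Pow (topspace T)"]) (auto dest: openin_subset)

lemma comult_lamT:
  assumes fin: "finite (topspace T)"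
  shows "comult QSym_alg (lamT T) =
    (\<Sum>Y | openin T Y. tensor (lamT (subtopology T (topspace T - Y))) (lamT (subtopology T Y)))"
proof -
  let ?C = "\<lambda>Y. subtopology T (topspace T - Y)" and ?S = "\<lambda>Y. subtopology T Y"
  let ?LC = "\<lambda>Y. lin_set_compositions (?C Y)" and ?LS = "\<lambda>Y. lin_set_compositions (?S Y)"
  let ?t = "\<lambda>Us Vs. tensor (M (map card Us)) (M (map card Vs))"
  have finC: "finite (?LC Y)" "finite (?LS Y)" for Y
    by (rule finite_lin_set_compositions, use fin in simp)+
  have "comult QSym_alg (lamT T) = (\<Sum>Xs\<in>lin_set_compositions T. qsym_coprod (map card Xs))"
    unfolding lamT_def lin_sum[OF lin_comult_QSym]
    by (intro sum.cong refl comult_QSym_M card_lin_set_composition_pos[OF fin])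
  also have "\<dots> = (\<Sum>Xs\<in>lin_set_compositions T. \<Sum>i\<in>{..length Xs}. ?t (take i Xs) (drop i Xs))"
    by (simp add: qsym_coprod_def take_map drop_map)
  also have "\<dots> = (\<Sum>(Xs, i)\<in>(SIGMA Xs:lin_set_compositions T. {..length Xs}). ?t (take i Xs) (drop i Xs))"
    by (rule sum.Sigma) (use finite_lin_set_compositions[OF fin] in auto)
  \<comment> \<open>The open set is the union of the tail, and the place of the cut is recovered as
    the length of the head.\<close>
  also have "\<dots> = (\<Sum>(Y, Us, Vs)\<in>(SIGMA Y:{Y. openin T Y}. ?LC Y \<times> ?LS Y). ?t Us Vs)"
  proof (rule sum.reindex_bij_witness[of _ "\<lambda>(Y, Us, Vs). (Us @ Vs, length Us)"
        "\<lambda>(Xs, i). (\<Union>(set (drop i Xs)), take i Xs, drop i Xs)"])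
    fix p assume "p \<in> (SIGMA Xs:lin_set_compositions T. {..length Xs})"
    then obtain Xs i where p: "p = (Xs, i)" and Xs: "Xs \<in> lin_set_compositions T" and i: "i \<le> length Xs"
      by auto
    show "(case case p of (Xs, i) \<Rightarrow> (\<Union>(set (drop i Xs)), take i Xs, drop i Xs) of
        (Y, Us, Vs) \<Rightarrow> (Us @ Vs, length Us)) = p" using p i by simp
    have "take i Xs @ drop i Xs \<in> lin_set_compositions T" using Xs by simp
    then show "(case p of (Xs, i) \<Rightarrow> (\<Union>(set (drop i Xs)), take i Xs, drop i Xs))
        \<in> (SIGMA Y:{Y. openin T Y}. ?LC Y \<times> ?LS Y)"
      unfolding p append_in_lin_set_compositions[OF fin] by simp
    show "(case case p of (Xs, i) \<Rightarrow> (\<Union>(set (drop i Xs)), take i Xs, drop i Xs) of (Y, Us, Vs) \<Rightarrow> ?t Us Vs)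
        = (case p of (Xs, i) \<Rightarrow> ?t (take i Xs) (drop i Xs))" by (simp add: p)
  next
    fix p assume "p \<in> (SIGMA Y:{Y. openin T Y}. ?LC Y \<times> ?LS Y)"
    then obtain Y Us Vs where p: "p = (Y, Us, Vs)" and Y: "openin T Y" and Us: "Us \<in> ?LC Y" and Vs: "Vs \<in> ?LS Y"
      by auto
    have un: "\<Union>(set Vs) = Y"
      using Vs lin_set_compositions_subtopology_iff[OF openin_subset[OF Y]] by blast
    show "(case case p of (Y, Us, Vs) \<Rightarrow> (Us @ Vs, length Us) of
        (Xs, i) \<Rightarrow> (\<Union>(set (drop i Xs)), take i Xs, drop i Xs)) = p" by (simp add: p un)
    have "Us @ Vs \<in> lin_set_compositions T"
      unfolding append_in_lin_set_compositions[OF fin] un using Y Us Vs by blast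
    then show "(case p of (Y, Us, Vs) \<Rightarrow> (Us @ Vs, length Us)) \<in> (SIGMA Xs:lin_set_compositions T. {..length Xs})"
      by (simp add: p)
  qed
  also have "\<dots> = (\<Sum>Y | openin T Y. \<Sum>(Us, Vs)\<in>?LC Y \<times> ?LS Y. ?t Us Vs)"
    by (rule sum.Sigma[symmetric]) (use finite_openin[OF fin] finC in auto)
  also have "\<dots> = (\<Sum>Y | openin T Y. tensor (lamT (?C Y)) (lamT (?S Y)))"
    unfolding sum.cartesian_product[symmetric] lamT_def tensor_sum_left
    by (simp only: tensor_sum_right)
  finally show ?thesis .
qed

text \<open>The blocks have positive sizes, so the empty composition can only come from the empty
  list of blocks, which is compatible with the empty space alone.\<close>

lemma lookup_lamT_Nil:
  assumes fin: "finite (topspace T)"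
  shows "Poly_Mapping.lookup (lamT T) (Abs_composition []) = (if topspace T = {} then 1 else 0)"
proof -
  have eq: "Poly_Mapping.lookup (M (map card Xs)) (Abs_composition []) = (if Xs = [] then 1 else 0)"
    if "Xs \<in> lin_set_compositions T" for Xs
    using card_lin_set_composition_pos[OF fin that]
    by (simp add: M_def lookup_bas Abs_composition_inject)
  have mem: "[] \<in> lin_set_compositions T \<longleftrightarrow> topspace T = {}"
    by (simp add: lin_set_compositions_def eq_commute[of "{}"])
  have "Poly_Mapping.lookup (lamT T) (Abs_composition []) = (\<Sum>Xs\<in>lin_set_compositions T. if Xs = [] then 1 else 0)"
    unfolding lamT_def lookup_sum using eq by (rule sum.cong[OF refl])
  also have "\<dots> = (if [] \<in> lin_set_compositions T then 1 else 0)"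
    using finite_lin_set_compositions[OF fin] by simp
  finally show ?thesis unfolding mem .
qed

lemma lamT_empty:
  assumes "topspace T = {}"
  shows "lamT T = M []"
proof -
  have "Xs = []" if "Xs \<in> lin_set_compositions T" for Xs
  proof (rule ccontr)
    assume "Xs \<noteq> []"
    then obtain A As where "Xs = A # As" by (cases Xs) auto
    with that assms show False by (auto simp: lin_set_compositions_def)
  qed
  moreover have "[] \<in> lin_set_compositions T" using assms by (simp add: lin_set_compositions_def)
  ultimately have "lin_set_compositions T = {[]}" by blast
  then show ?thesis by (simp add: lamT_def)
qed

section \<open>The Hopf algebra morphism\<close>

lemma lin_lam: "lin (lam Z)"
  by (simp add: lam_def lin_lin_ext)

text \<open>The definite description is met by \<open>lamT\<close>, and by nothing else because
  \<open>realize\<close> is injective over an infinite alphabet.\<close>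

lemma lam_bas:
  fixes Z :: "'z::linorder set"
  assumes "infinite Z"
  shows "lam Z (bas C) = (lamT (rep_ftop_class C) :: composition \<Rightarrow>\<^sub>0 'k::field)"
proof -
  have "(THE q. realize Z q = (top_series Z (rep_ftop_class C) :: _ \<Rightarrow> 'k)) = lamT (rep_ftop_class C)"
  proof (rule the_equality)
    show re: "realize Z (lamT (rep_ftop_class C)) = (top_series Z (rep_ftop_class C) :: _ \<Rightarrow> 'k)"
      by (rule realize_lamT[OF finite_rep_ftop_class])
    show "q = lamT (rep_ftop_class C)" if "realize Z q = (top_series Z (rep_ftop_class C) :: _ \<Rightarrow> 'k)" for q
      by (rule realize_inj[OF assms]) (simp only: that re)
  qed
  then show ?thesis by (simp add: lam_def)
qed

lemma lam_homeo_class: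
  "infinite Z \<Longrightarrow> finite (topspace T) \<Longrightarrow> lam Z (bas (homeo_class T)) = lamT T"
  by (simp add: lam_bas lamT_rep_homeo_class)

lemma lin_mult_H_left: "lin (\<lambda>x. mult H_alg x y)"
  by (simp add: H_alg_def lin_bilin_ext_left)

lemma lin_mult_H_right: "lin (mult H_alg x)"
  by (simp add: H_alg_def lin_bilin_ext_right)

lemma lin_comult_H: "lin (comult H_alg)"
  by (simp add: H_alg_def lin_lin_ext)

lemma lin_mult_tensor: "lin (mult_tensor A)"
  unfolding mult_tensor_def by (rule lin_lin_ext)

lemma mult_tensor_tensor:
  assumes "\<And>y. lin (\<lambda>x. mult A x y)" "\<And>x. lin (mult A x)"
  shows "mult_tensor A (tensor x y) = mult A x y"
proof (rule bilin_eqI[of "\<lambda>x y. mult_tensor A (tensor x y)" "mult A", OF _ _ assms])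
  show "lin (\<lambda>x. mult_tensor A (tensor x y))" for y
    by (rule lin_comp[OF lin_mult_tensor lin_tensor_left])
  show "lin (\<lambda>y. mult_tensor A (tensor x y))" for x
    by (rule lin_comp[OF lin_mult_tensor lin_tensor_right])
qed (simp add: mult_tensor_def)

lemma lam_mult:
  assumes Z: "infinite Z"
  shows "lam Z (mult H_alg x y) = mult QSym_alg (lam Z x) (lam Z y)"
proof (rule bilin_eqI[of "\<lambda>x y. lam Z (mult H_alg x y)" "\<lambda>x y. mult QSym_alg (lam Z x) (lam Z y)"])
  show "lin (\<lambda>x. lam Z (mult H_alg x y))" for y by (rule lin_comp[OF lin_lam lin_mult_H_left])
  show "lin (\<lambda>y. lam Z (mult H_alg x y))" for x by (rule lin_comp[OF lin_lam lin_mult_H_right])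
  show "lin (\<lambda>x. mult QSym_alg (lam Z x) (lam Z y))" for y
    by (rule lin_comp[OF lin_mult_QSym_left lin_lam])
  show "lin (\<lambda>y. mult QSym_alg (lam Z x) (lam Z y))" for x
    by (rule lin_comp[OF lin_mult_QSym_right lin_lam])
  fix C D
  let ?S = "rep_ftop_class C" and ?T = "rep_ftop_class D"
  have "finite (topspace (disj_union_top ?S ?T))"
    by (auto simp: disj_union_top_def finite_rep_ftop_class)
  then have "lam Z (bas (homeo_class (disj_union_top ?S ?T))) = mult QSym_alg (lamT ?S) (lamT ?T)"
    by (simp add: lam_homeo_class[OF Z] lamT_disj_union_top finite_rep_ftop_class)
  then show "lam Z (mult H_alg (bas C) (bas D)) = mult QSym_alg (lam Z (bas C)) (lam Z (bas D))"
    by (simp add: H_alg_def lam_bas[OF Z])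
qed

lemma lam_empty_class: "infinite Z \<Longrightarrow> lam Z (bas empty_class) = M []"
  by (simp add: empty_class_def lam_homeo_class lamT_empty)

lemma comult_H_bas:
  "comult H_alg (bas C) = (\<Sum>Y | openin (rep_ftop_class C) Y.
     tensor (bas (homeo_class (subtopology (rep_ftop_class C) (topspace (rep_ftop_class C) - Y))))
            (bas (homeo_class (subtopology (rep_ftop_class C) Y))))"
  by (simp add: H_alg_def top_coprod_def)

lemma lam_comult:
  assumes Z: "infinite Z"
  shows "comult QSym_alg (lam Z x) = tensor_map (lam Z) (lam Z) (comult H_alg x)"
proof (rule lin_eqI[of "\<lambda>x. comult QSym_alg (lam Z x)" "\<lambda>x. tensor_map (lam Z) (lam Z) (comult H_alg x)"])
  show "lin (\<lambda>x. comult QSym_alg (lam Z x))" by (rule lin_comp[OF lin_comult_QSym lin_lam])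
  show "lin (\<lambda>x. tensor_map (lam Z) (lam Z) (comult H_alg x))"
    by (rule lin_comp[OF lin_tensor_map lin_comult_H])
  fix C
  have fin: "finite (topspace (subtopology (rep_ftop_class C) Y))" for Y
    by (simp add: finite_rep_ftop_class)
  show "comult QSym_alg (lam Z (bas C)) = tensor_map (lam Z) (lam Z) (comult H_alg (bas C))"
    unfolding comult_H_bas lam_bas[OF Z] comult_lamT[OF finite_rep_ftop_class] lin_sum[OF lin_tensor_map]
      tensor_map_tensor[OF lin_lam lin_lam] lamT_rep_homeo_class[OF fin] ..
qed

lemma topspace_rep_empty_iff: "topspace (rep_ftop_class C) = {} \<longleftrightarrow> C = empty_class"
proof
  assume "topspace (rep_ftop_class C) = {}"
  then show "C = empty_class" using homeo_class_empty[of "rep_ftop_class C"] homeo_class_rep by metis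
next
  assume C: "C = empty_class"
  have "card (topspace (rep_ftop_class C)) = card (topspace (discrete_topology ({} :: nat set)))"
    unfolding C empty_class_def by (rule homeomorphic_space_card[OF rep_homeo_class]) simp
  then show "topspace (rep_ftop_class C) = {}" using finite_rep_ftop_class[of C] by simp
qed

text \<open>The counits take scalar values, so \<open>lin_eqI\<close> does not apply and
  \<open>x\<close> is expanded by hand.\<close>

lemma lam_counit:
  fixes x :: "ftop_class \<Rightarrow>\<^sub>0 'k::field"
  assumes Z: "infinite Z"
  shows "counit QSym_alg (lam Z x) = counit H_alg x"
proof -
  have 1: "counit QSym_alg (lam Z (bas C)) = (if C = empty_class then 1 else 0 :: 'k)" for C
    using lookup_lamT_Nil[OF finite_rep_ftop_class[of C]] topspace_rep_empty_iff[of C]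
    by (simp add: QSym_alg_def lam_bas[OF Z])
  have "counit QSym_alg (lam Z x)
      = (\<Sum>C\<in>Poly_Mapping.keys x. Poly_Mapping.lookup x C * counit QSym_alg (lam Z (bas C)))"
    by (subst lin_ext_lin[OF lin_lam[of Z], symmetric]) (simp add: lin_ext_def QSym_alg_def lookup_sum)
  also have "\<dots> = (\<Sum>C\<in>Poly_Mapping.keys x. if C = empty_class then Poly_Mapping.lookup x C else 0)"
    by (intro sum.cong refl) (simp add: 1)
  also have "\<dots> = counit H_alg x" by (simp add: H_alg_def in_keys_iff)
  finally show ?thesis .
qed

text \<open>
  Both \<open>lam Z \<circ> S\<close> and \<open>S' \<circ> lam Z\<close> are left convolution inverses of \<open>lam Z\<close>. As the term
  \<open>Y = {}\<close> of the coproduct is \<open>C \<otimes> 1\<close>, a left convolution inverse is determined recursively.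
\<close>

lemma lam_antipode:
  fixes Z :: "'z::linorder set" and x :: "ftop_class \<Rightarrow>\<^sub>0 'k::field"
  assumes Z: "infinite Z" and S: "is_antipode H_alg S" and S': "is_antipode QSym_alg S'"
  shows "lam Z (S x) = S' (lam Z x)"
proof (rule lin_eqI[of "\<lambda>x. lam Z (S x)" "\<lambda>x. S' (lam Z x)"])
  have lS: "lin S" and lS': "lin S'" using S S' by (auto simp: is_antipode_def)
  show "lin (\<lambda>x. lam Z (S x))" by (rule lin_comp[OF lin_lam lS])
  show "lin (\<lambda>x. S' (lam Z x))" by (rule lin_comp[OF lS' lin_lam])
  let ?T = "rep_ftop_class"
  let ?p = "\<lambda>C Y. homeo_class (subtopology (?T C) (topspace (?T C) - Y))"
  let ?q = "\<lambda>C Y. homeo_class (subtopology (?T C) Y)"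
  have lid: "lin (id :: (ftop_class \<Rightarrow>\<^sub>0 'k) \<Rightarrow> _)" "lin (id :: (composition \<Rightarrow>\<^sub>0 'k) \<Rightarrow> _)"
    by (simp_all add: lin_iff)
  \<comment> \<open>Two identities with the same right side: here the antipode identity of
    \<open>H_alg\<close> under \<open>lam Z\<close>, next the antipode identity of
    \<open>QSym_alg\<close> at \<open>lam Z (bas C)\<close>, both rewritten by the properties
    already proved for \<open>lam Z\<close>.\<close>
  have E1: "(\<Sum>Y | openin (?T C) Y. mult QSym_alg (lam Z (S (bas (?p C Y)))) (lam Z (bas (?q C Y))))
      = smul (counit H_alg (bas C :: _ \<Rightarrow>\<^sub>0 'k)) (M [])" for C
  proof -
    have "mult_tensor H_alg (tensor_map S id (comult H_alg (bas C)))
        = smul (counit H_alg (bas C)) (unit H_alg)" using S by (simp add: is_antipode_def)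
    then have "lam Z (mult_tensor H_alg (tensor_map S id (comult H_alg (bas C))))
        = smul (counit H_alg (bas C)) (lam Z (unit H_alg))" by (simp add: lin_smul[OF lin_lam])
    moreover have "lam Z (unit H_alg :: _ \<Rightarrow>\<^sub>0 'k) = M []" by (simp add: H_alg_def lam_empty_class[OF Z])
    ultimately show ?thesis
      by (simp only: comult_H_bas lin_sum[OF lin_tensor_map] lin_sum[OF lin_mult_tensor] lin_sum[OF lin_lam]
          tensor_map_tensor[OF lS lid(1)] mult_tensor_tensor[OF lin_mult_H_left lin_mult_H_right]
          lam_mult[OF Z] id_apply)
  qed
  have E2: "(\<Sum>Y | openin (?T C) Y. mult QSym_alg (S' (lam Z (bas (?p C Y)))) (lam Z (bas (?q C Y))))
      = smul (counit H_alg (bas C :: _ \<Rightarrow>\<^sub>0 'k)) (M [])" for C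
  proof -
    have "mult_tensor QSym_alg (tensor_map S' id (comult QSym_alg (lam Z (bas C))))
        = smul (counit QSym_alg (lam Z (bas C))) (unit QSym_alg)" using S' by (simp add: is_antipode_def)
    moreover have "unit QSym_alg = (M [] :: _ \<Rightarrow>\<^sub>0 'k)" by (simp add: QSym_alg_def)
    ultimately show ?thesis
      by (simp only: lam_comult[OF Z] lam_counit[OF Z] comult_H_bas lin_sum[OF lin_tensor_map] lin_sum[OF lin_mult_tensor]
          tensor_map_tensor[OF lin_lam lin_lam]
          tensor_map_tensor[OF lS' lid(2)] mult_tensor_tensor[OF lin_mult_QSym_left lin_mult_QSym_right]
          id_apply)
  qed
  fix C
  show "lam Z (S (bas C)) = S' (lam Z (bas C))"
  proof (induction C rule: measure_induct_rule[of "\<lambda>C. card (topspace (?T C))"])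
    case (less C)
    let ?X = "topspace (?T C)"
    let ?O = "{Y. openin (?T C) Y}"
    have finO: "finite ?O" by (rule finite_openin[OF finite_rep_ftop_class])
    have O: "{} \<in> ?O" by simp
    have p0: "?p C {} = C" by (simp add: homeo_class_rep)
    have q0: "?q C {} = empty_class" by (rule homeo_class_empty) simp
    have IH: "lam Z (S (bas (?p C Y))) = S' (lam Z (bas (?p C Y)))" if Y: "Y \<in> ?O - {{}}" for Y
    proof (rule less.IH)
      have sub: "Y \<subseteq> ?X" "Y \<noteq> {}" using Y openin_subset by auto
      have "card (topspace (?T (?p C Y))) = card (topspace (subtopology (?T C) (?X - Y)))"
        by (rule homeomorphic_space_card[OF rep_homeo_class]) (simp add: finite_rep_ftop_class)
      also have "topspace (subtopology (?T C) (?X - Y)) = ?X - Y" by auto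
      also have "card (?X - Y) < card ?X"
        using sub finite_rep_ftop_class[of C] by (intro psubset_card_mono) auto
      finally show "card (topspace (?T (?p C Y))) < card ?X" .
    qed
    have "lam Z (S (bas C)) + (\<Sum>Y\<in>?O - {{}}. mult QSym_alg (lam Z (S (bas (?p C Y)))) (lam Z (bas (?q C Y))))
        = S' (lam Z (bas C)) + (\<Sum>Y\<in>?O - {{}}. mult QSym_alg (S' (lam Z (bas (?p C Y)))) (lam Z (bas (?q C Y))))"
      using trans[OF E1[of C] E2[of C, symmetric]]
      unfolding sum.remove[OF finO O] p0 q0 lam_empty_class[OF Z] mult_QSym_one_right .
    moreover have "(\<Sum>Y\<in>?O - {{}}. mult QSym_alg (lam Z (S (bas (?p C Y)))) (lam Z (bas (?q C Y))))
        = (\<Sum>Y\<in>?O - {{}}. mult QSym_alg (S' (lam Z (bas (?p C Y)))) (lam Z (bas (?q C Y))))"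
      by (intro sum.cong refl) (simp only: IH)
    ultimately show ?case by simp
  qed
qed

lemma lam_hopf_morphism:
  "infinite Z \<Longrightarrow> hopf_algebra_morphism H_alg QSym_alg (lam Z)"
  unfolding hopf_algebra_morphism_def
  using lin_lam lam_mult lam_comult lam_counit lam_antipode
  by (auto simp: lam_empty_class H_alg_def[THEN arg_cong[where f = unit]] QSym_alg_def[THEN arg_cong[where f = unit]])

section \<open>Admissible topologies and weakly increasing set compositions\<close>

text \<open>Compatible set compositions without flatness: strict relations may stay inside a block.
  Equivalent points still share a block, since \<open>below\<close> excludes relations back to an
  earlier one.\<close>

definition weak_set_compositions :: "'a topology \<Rightarrow> 'a set list set" where
  "weak_set_compositions T = {Ys. {} \<notin> set Ys \<and> \<Union>(set Ys) = topspace T \<and> sorted_wrt (below T) Ys}"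

text \<open>For disjoint blocks, this is the disjoint union of the restrictions of \<open>T\<close>
  to them, kept on the same points.\<close>

definition block_top :: "'a topology \<Rightarrow> 'a set list \<Rightarrow> 'a topology" where
  "block_top T Ys = upset_topology (\<Union>(set Ys)) (\<lambda>x y. top_le T x y \<and> (\<exists>A\<in>set Ys. x \<in> A \<and> y \<in> A))"

lemma topspace_block_top [simp]: "topspace (block_top T Ys) = \<Union>(set Ys)"
  by (simp add: block_top_def)

lemma sorted_wrt_below_disjnt:
  assumes "\<Union>(set Ys) \<subseteq> topspace T" "sorted_wrt (below T) Ys"
  shows "sorted_wrt disjnt Ys"
proof (rule sorted_wrt_mono_rel[OF _ assms(2)])
  fix A B assume A: "A \<in> set Ys" and bl: "below T A B"
  have "x \<notin> B" if "x \<in> A" for x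
  proof
    assume "x \<in> B"
    have "x \<in> topspace T" using A that assms(1) by blast
    then show False using bl that \<open>x \<in> B\<close> top_le_refl[of x T] by (simp add: below_def)
  qed
  then show "disjnt A B" by (auto simp: disjnt_iff)
qed

lemma sorted_wrt_disjnt_same:
  assumes "sorted_wrt disjnt Ys" "A \<in> set Ys" "B \<in> set Ys" "x \<in> A" "x \<in> B"
  shows "A = B"
proof -
  obtain i j where ij: "i < length Ys" "A = Ys ! i" "j < length Ys" "B = Ys ! j"
    using assms(2,3) by (auto simp: in_set_conv_nth)
  then have "\<not> disjnt (Ys ! i) (Ys ! j)" using assms(4,5) by (auto simp: disjnt_iff)
  then have "i = j" using assms(1)[unfolded sorted_wrt_disjnt_iff] ij by blast
  then show ?thesis using ij by simp
qed

lemma top_le_block_top: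
  assumes sub: "\<Union>(set Ys) \<subseteq> topspace T" and dj: "sorted_wrt disjnt Ys"
  shows "top_le (block_top T Ys) x y \<longleftrightarrow> top_le T x y \<and> (\<exists>A\<in>set Ys. x \<in> A \<and> y \<in> A)"
proof -
  have "top_le (block_top T Ys) x y \<longleftrightarrow> x \<in> \<Union>(set Ys) \<and> y \<in> \<Union>(set Ys) \<and>
      (top_le T x y \<and> (\<exists>A\<in>set Ys. x \<in> A \<and> y \<in> A))"
    unfolding block_top_def
  proof (rule top_le_upset_topology)
    show "top_le T x x \<and> (\<exists>A\<in>set Ys. x \<in> A \<and> x \<in> A)" if "x \<in> \<Union>(set Ys)" for x
      using that sub top_le_refl[of x T] by blast
    \<comment> \<open>Transitivity is where disjointness enters: the middle point lies in both
      blocks and thereby identifies them.\<close>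
    show "top_le T x z \<and> (\<exists>A\<in>set Ys. x \<in> A \<and> z \<in> A)"
      if xy: "top_le T x y \<and> (\<exists>A\<in>set Ys. x \<in> A \<and> y \<in> A)"
        and yz: "top_le T y z \<and> (\<exists>A\<in>set Ys. y \<in> A \<and> z \<in> A)" for x y z
    proof -
      obtain A where A: "A \<in> set Ys" "x \<in> A" "y \<in> A" using xy by blast
      obtain B where B: "B \<in> set Ys" "y \<in> B" "z \<in> B" using yz by blast
      have "A = B" by (rule sorted_wrt_disjnt_same[OF dj A(1) B(1) A(3) B(2)])
      then show ?thesis using A B xy yz top_le_trans[of T x y z] by blast
    qed
  qed
  then show ?thesis by blast
qed

section \<open>Quotients, connectedness and admissibility\<close>

lemma top_le_quot_top:
  "top_le (quot_top T T') x y \<longleftrightarrow>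
     x \<in> topspace T \<and> y \<in> topspace T \<and> (\<lambda>x y. top_le T x y \<or> top_le T' y x)\<^sup>+\<^sup>+ x y"
  unfolding quot_top_def
proof (rule top_le_upset_topology)
  show "(\<lambda>x y. top_le T x y \<or> top_le T' y x)\<^sup>+\<^sup>+ x x" if "x \<in> topspace T" for x
    using top_le_refl[OF that] by blast
qed (rule tranclp_trans)

lemma topspace_quot_top [simp]: "topspace (quot_top T T') = topspace T"
  by (simp add: quot_top_def)

lemma tranclp_comparable_sym:
  assumes "(\<lambda>x y. top_le T x y \<or> top_le T y x)\<^sup>+\<^sup>+ x y"
  shows "(\<lambda>x y. top_le T x y \<or> top_le T y x)\<^sup>+\<^sup>+ y x"
  using assms
proof (induction rule: tranclp_induct)
  case (step y z)
  then have "(\<lambda>x y. top_le T x y \<or> top_le T y x)\<^sup>+\<^sup>+ z y" by blast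
  then show ?case using step.IH by (rule tranclp_trans)
qed blast

text \<open>If the class were separated by two open sets, some step of a chain of comparabilities
  would cross from one to the other; as open sets are upwards closed, the larger point of that step
  would lie in both.\<close>

lemma connectedin_comparability_component:
  assumes x: "x \<in> topspace T"
  shows "connectedin T {y. (\<lambda>x y. top_le T x y \<or> top_le T y x)\<^sup>+\<^sup>+ x y}" (is "connectedin T ?C")
proof -
  let ?R = "\<lambda>x y. top_le T x y \<or> top_le T y x"
  have sub: "?C \<subseteq> topspace T"
  proof
    fix y assume "y \<in> ?C"
    then have "?R\<^sup>+\<^sup>+ x y" by simp
    then show "y \<in> topspace T" by (induction rule: tranclp_induct) (auto dest: top_leD)
  qed
  have key: False if E: "openin T E" "openin T F" "?C \<subseteq> E \<union> F" "E \<inter> F \<inter> ?C = {}" "x \<in> E" "y \<in> F" "y \<in> ?C" for E F y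
  proof -
    have xC: "x \<in> ?C" using top_le_refl[OF x] by blast
    have "?R\<^sup>+\<^sup>+ x y" using E(7) by simp
    then have "y \<in> E"
    proof (induction rule: tranclp_induct)
      case (base z)
      then have zC: "z \<in> ?C" by blast
      show ?case
      proof (rule ccontr)
        assume "z \<notin> E"
        then have "z \<in> F" using E(3) zC by blast
        then show False using base \<open>z \<notin> E\<close> E xC unfolding top_le_def by blast
      qed
    next
      case (step w z)
      have wC: "w \<in> ?C" using step by simp
      have zC: "z \<in> ?C" using tranclp.trancl_into_trancl[OF step(1,2)] by simp
      show ?case
      proof (rule ccontr)
        assume "z \<notin> E"
        then have "z \<in> F" using E(3) zC by blast
        then show False using step(2,3) \<open>z \<notin> E\<close> E wC unfolding top_le_def by blast
      qed
    qed
    then show False using E by blast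
  qed
  have xC: "x \<in> ?C" using top_le_refl[OF x] by blast
  show ?thesis
    unfolding connectedin
  proof (intro conjI notI sub)
    assume "\<exists>E1 E2. openin T E1 \<and> openin T E2 \<and> ?C \<subseteq> E1 \<union> E2 \<and> E1 \<inter> E2 \<inter> ?C = {} \<and> E1 \<inter> ?C \<noteq> {} \<and> E2 \<inter> ?C \<noteq> {}"
    then obtain E F y z where E: "openin T E" "openin T F" "?C \<subseteq> E \<union> F" "E \<inter> F \<inter> ?C = {}"
      and y: "y \<in> E" "y \<in> ?C" and z: "z \<in> F" "z \<in> ?C" by blast
    have "x \<in> E \<or> x \<in> F" using E(3) xC by blast
    then show False
    proof
      assume "x \<in> E"
      then show False by (rule key[OF E _ z])
    next
      assume "x \<in> F"
      moreover have "?C \<subseteq> F \<union> E" "F \<inter> E \<inter> ?C = {}" using E(3,4) by auto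
      ultimately show False using key[OF E(2,1) _ _ _ y] by simp
    qed
  qed
qed

text \<open>Here \<open>p\<close> is a level: relations of \<open>T\<close> never lower it, and
  \<open>T'\<close> keeps those that preserve it. So generating steps of the quotient never lower
  the level, and a chain between points of equal level stays in that level, where all its steps are
  comparabilities in \<open>T'\<close>.\<close>

lemma admissible_block:
  fixes p :: "'a \<Rightarrow> nat"
  assumes fin: "finite (topspace T)" and ts: "topspace T' = topspace T"
    and mono: "\<And>x y. top_le T x y \<Longrightarrow> p x \<le> p y"
    and le: "\<And>x y. top_le T' x y \<longleftrightarrow> top_le T x y \<and> p x = p y"
  shows "admissible T T'"
    and "top_le (quot_top T T') x y \<Longrightarrow> p x \<le> p y \<and> (p x = p y \<longrightarrow> top_le (quot_top T T') y x)"
proof -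
  let ?R = "\<lambda>x y. top_le T x y \<or> top_le T' y x" and ?R' = "\<lambda>x y. top_le T' x y \<or> top_le T' y x"
  have fin': "finite (topspace T')" using fin ts by simp
  have step: "p x \<le> p y \<and> (p x = p y \<longrightarrow> ?R'\<^sup>+\<^sup>+ x y)" if "?R\<^sup>+\<^sup>+ x y" for x y
    using that
  proof (induction rule: tranclp_induct)
    case (base y)
    then have "p x \<le> p y" using mono le by auto
    moreover have "p x = p y \<Longrightarrow> ?R' x y" using base le by auto
    ultimately show ?case by blast
  next
    case (step y z)
    then have yz: "p y \<le> p z" using mono le by auto
    have "?R'\<^sup>+\<^sup>+ x z" if "p x = p z"
    proof -
      have eq: "p x = p y" "p y = p z" using that yz step.IH by auto
      have "?R' y z" using step(2) le eq by auto
      moreover have "?R'\<^sup>+\<^sup>+ x y" using step.IH eq by blast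
      ultimately show ?thesis by (rule tranclp.trancl_into_trancl[rotated])
    qed
    then show ?case using yz step.IH by auto
  qed
  have up: "?R\<^sup>+\<^sup>+ x y" if "?R'\<^sup>+\<^sup>+ x y" for x y
    using that
  proof (induction rule: tranclp_induct)
    case (base y)
    then show ?case using le by blast
  next
    case (step y z)
    have "?R y z" using step(2) le by blast
    with step.IH show ?case by (rule tranclp.trancl_into_trancl)
  qed
  have R': "top_le (quot_top T' T') x y \<longleftrightarrow> x \<in> topspace T \<and> y \<in> topspace T \<and> ?R'\<^sup>+\<^sup>+ x y" for x y
    using top_le_quot_top[of T' T'] ts by simp
  show "admissible T T'"
    unfolding admissible_def
  proof (intro conjI ballI allI impI)
    show "finer_top T' T"
      unfolding finer_top_def openin_iff_top_le[OF fin] openin_iff_top_le[OF fin'] using ts le by auto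
    show "subtopology T' Y = subtopology T Y" if Y: "connectedin T' Y" for Y
    proof (rule topology_eq_top_leI)
      show "finite (topspace (subtopology T Y))" using fin by simp
      show "topspace (subtopology T' Y) = topspace (subtopology T Y)" using ts by simp
      \<comment> \<open>A level set and its complement are both open in \<open>T'\<close>, so a
        connected set has a single level.\<close>
      have p: "p x = p y" if xy: "x \<in> Y" "y \<in> Y" for x y
      proof (rule ccontr)
        assume ne: "p x \<noteq> p y"
        have sub: "Y \<subseteq> topspace T'" using Y by (rule connectedin_subset_topspace)
        let ?E = "{z \<in> topspace T'. p z = p x}" and ?F = "{z \<in> topspace T'. p z \<noteq> p x}"
        have "openin T' ?E" "openin T' ?F"
          unfolding openin_iff_top_le[OF fin'] using le top_leD[of T'] by auto
        moreover have "Y \<subseteq> ?E \<union> ?F" "?E \<inter> ?F \<inter> Y = {}" "?E \<inter> Y \<noteq> {}" "?F \<inter> Y \<noteq> {}"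
          using sub xy ne by auto
        ultimately show False using Y unfolding connectedin by blast
      qed
      show "top_le (subtopology T' Y) x y \<longleftrightarrow> top_le (subtopology T Y) x y" for x y
        unfolding top_le_subtopology using le p by blast
    qed
    fix x y assume x: "x \<in> topspace T" and y: "y \<in> topspace T"
    show "top_sim (quot_top T T') x y \<longleftrightarrow> top_sim (quot_top T' T') x y"
    proof
      assume "top_sim (quot_top T T') x y"
      then have "?R\<^sup>+\<^sup>+ x y" "?R\<^sup>+\<^sup>+ y x" by (auto simp: top_sim_def top_le_quot_top)
      then have "?R'\<^sup>+\<^sup>+ x y" using step[of x y] step[of y x] by auto
      then show "top_sim (quot_top T' T') x y"
        using x y tranclp_comparable_sym[of T' x y] unfolding top_sim_def R' by blast
    next
      assume "top_sim (quot_top T' T') x y"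
      then have "?R\<^sup>+\<^sup>+ x y" "?R\<^sup>+\<^sup>+ y x" unfolding top_sim_def R' using up by simp_all
      then show "top_sim (quot_top T T') x y" using x y by (simp add: top_sim_def top_le_quot_top)
    qed
  qed
  assume q: "top_le (quot_top T T') x y"
  then have R: "?R\<^sup>+\<^sup>+ x y" by (simp add: top_le_quot_top)
  have "top_le (quot_top T T') y x" if "p x = p y"
    using step[OF R] that up[OF tranclp_comparable_sym[of T' x y]] q by (simp add: top_le_quot_top)
  then show "p x \<le> p y \<and> (p x = p y \<longrightarrow> top_le (quot_top T T') y x)" using step[OF R] by blast
qed

lemma weak_set_composition_admissible:
  assumes fin: "finite (topspace T)" and Ys: "Ys \<in> weak_set_compositions T"
  shows "admissible T (block_top T Ys) \<and> Ys \<in> lin_set_compositions (quot_top T (block_top T Ys))"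
proof -
  have un: "\<Union>(set Ys) = topspace T" and bl: "sorted_wrt (below T) Ys" and ne: "{} \<notin> set Ys"
    using Ys by (auto simp: weak_set_compositions_def)
  have dj: "sorted_wrt disjnt Ys" by (rule sorted_wrt_below_disjnt[OF equalityD1[OF un] bl])
  \<comment> \<open>The level of a point is the index of its block.\<close>
  define p where "p x = (THE i. i < length Ys \<and> x \<in> Ys ! i)" for x
  have p_eq: "p x = i" if "i < length Ys" "x \<in> Ys ! i" for x i
    unfolding p_def
  proof (rule the_equality)
    fix j assume j: "j < length Ys \<and> x \<in> Ys ! j"
    then have "\<not> disjnt (Ys ! j) (Ys ! i)" using that by (auto simp: disjnt_iff)
    then show "j = i" using dj[unfolded sorted_wrt_disjnt_iff] j that by blast
  qed (use that in blast)
  have p_mem: "p x < length Ys \<and> x \<in> Ys ! p x" if "x \<in> topspace T" for x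
  proof -
    have "x \<in> \<Union>(set Ys)" using that un by simp
    then obtain i where "i < length Ys" "x \<in> Ys ! i" by (auto simp: in_set_conv_nth)
    then show ?thesis using p_eq[of i x] by simp
  qed
  have mono: "p x \<le> p y" if le: "top_le T x y" for x y
  proof (rule ccontr)
    assume "\<not> p x \<le> p y"
    then have "below T (Ys ! p y) (Ys ! p x)"
      using bl p_mem[of x] top_leD[OF le] by (auto simp: sorted_wrt_iff_nth_less)
    then show False using p_mem[of x] p_mem[of y] top_leD[OF le] le by (auto simp: below_def)
  qed
  have le: "top_le (block_top T Ys) x y \<longleftrightarrow> top_le T x y \<and> p x = p y" for x y
  proof -
    have "(\<exists>A\<in>set Ys. x \<in> A \<and> y \<in> A) \<longleftrightarrow> p x = p y" if "top_le T x y"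
    proof
      assume "\<exists>A\<in>set Ys. x \<in> A \<and> y \<in> A"
      then obtain i where "i < length Ys" "x \<in> Ys ! i" "y \<in> Ys ! i" by (auto simp: in_set_conv_nth)
      then show "p x = p y" using p_eq by metis
    next
      assume "p x = p y"
      then show "\<exists>A\<in>set Ys. x \<in> A \<and> y \<in> A"
        using p_mem[of x] p_mem[of y] top_leD[OF that] by (metis nth_mem)
    qed
    then show ?thesis unfolding top_le_block_top[OF equalityD1[OF un] dj] by blast
  qed
  let ?Q = "quot_top T (block_top T Ys)"
  have ts: "topspace (block_top T Ys) = topspace T" using un by simp
  note ab = admissible_block[OF fin ts mono le]
  have "sorted_wrt (below ?Q) Ys"
    unfolding sorted_wrt_iff_nth_less below_def
  proof (intro allI impI ballI notI)
    fix i j x y assume ij: "i < j" "j < length Ys" and x: "x \<in> Ys ! i" and y: "y \<in> Ys ! j"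
      and "top_le ?Q y x"
    then have "p y \<le> p x" using ab(2) by blast
    then show False using p_eq[OF _ x] p_eq[OF _ y] ij by simp
  qed
  moreover have "flat ?Q A" if A: "A \<in> set Ys" for A
  proof -
    obtain i where i: "i < length Ys" "A = Ys ! i" using A by (auto simp: in_set_conv_nth)
    then show ?thesis unfolding flat_def using ab(2) p_eq[OF i(1)] by metis
  qed
  ultimately show ?thesis using ab(1) un ne by (simp add: lin_set_compositions_iff)
qed

text \<open>A relation of \<open>T'\<close> makes its points equivalent in the quotient, which puts
  them into one block. Conversely, a relation of \<open>T\<close> inside a block becomes an
  equivalence in the quotient by flatness. The condition on equivalences turns it into a chain of
  comparabilities in \<open>T'\<close>, and on the connected class so obtained \<open>T'\<close>
  agrees with \<open>T\<close>.\<close>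

lemma admissible_weak_set_composition:
  assumes fin: "finite (topspace T)" and ad: "admissible T T'"
    and Ys: "Ys \<in> lin_set_compositions (quot_top T T')"
  shows "Ys \<in> weak_set_compositions T \<and> T' = block_top T Ys"
proof -
  let ?Q = "quot_top T T'" and ?R' = "\<lambda>x y. top_le T' x y \<or> top_le T' y x"
  have fine: "finer_top T' T" and con: "\<And>Y. connectedin T' Y \<Longrightarrow> subtopology T' Y = subtopology T Y"
    and sim: "\<And>x y. x \<in> topspace T \<Longrightarrow> y \<in> topspace T \<Longrightarrow> top_sim ?Q x y \<longleftrightarrow> top_sim (quot_top T' T') x y"
    using ad unfolding admissible_def by auto
  have ts: "topspace T' = topspace T" using fine by (simp add: finer_top_def)
  have le: "top_le T x y" if "top_le T' x y" for x y
    using that fine ts unfolding finer_top_def top_le_def by blast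
  have leQ: "top_le ?Q x y" if "top_le T x y" for x y
    using that top_leD[OF that] unfolding top_le_quot_top by blast
  have leQ': "top_le ?Q y x" if "top_le T' x y" for x y
    using that top_leD[OF that] unfolding top_le_quot_top ts by blast
  have un: "\<Union>(set Ys) = topspace T" and ne: "{} \<notin> set Ys" and bl: "sorted_wrt (below ?Q) Ys"
    and fl: "\<And>A. A \<in> set Ys \<Longrightarrow> flat ?Q A"
    using Ys by (auto simp: lin_set_compositions_iff)
  have bl': "sorted_wrt (below T) Ys"
    by (rule sorted_wrt_mono_rel[OF _ bl]) (use leQ in \<open>auto simp: below_def\<close>)
  have dj: "sorted_wrt disjnt Ys" by (rule sorted_wrt_below_disjnt[OF equalityD1[OF un] bl'])
  have "T' = block_top T Ys"
  proof (rule topology_eq_top_leI)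
    show "finite (topspace (block_top T Ys))" using fin un by simp
    show "topspace T' = topspace (block_top T Ys)" using ts un by simp
    fix x y
    have "top_le T' x y \<longleftrightarrow> top_le T x y \<and> (\<exists>A\<in>set Ys. x \<in> A \<and> y \<in> A)"
    proof
      assume l: "top_le T' x y"
      have xy: "x \<in> \<Union>(set Ys)" "y \<in> \<Union>(set Ys)" using top_leD[OF l] ts un by auto
      then obtain i j where ij: "i < length Ys" "x \<in> Ys ! i" "j < length Ys" "y \<in> Ys ! j"
        by (auto simp: in_set_conv_nth)
      have "top_sim ?Q x y" using leQ[OF le[OF l]] leQ'[OF l] by (simp add: top_sim_def)
      then have "i = j" using Ys ij unfolding lin_set_compositions_def by blast
      then show "top_le T x y \<and> (\<exists>A\<in>set Ys. x \<in> A \<and> y \<in> A)" using ij le[OF l] nth_mem by blast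
    next
      assume r: "top_le T x y \<and> (\<exists>A\<in>set Ys. x \<in> A \<and> y \<in> A)"
      then obtain A where A: "A \<in> set Ys" "x \<in> A" "y \<in> A" and l: "top_le T x y" by blast
      have xX: "x \<in> topspace T" "y \<in> topspace T" using top_leD[OF l] by auto
      have "top_le ?Q y x" using leQ[OF l] fl[OF A(1)] A unfolding flat_def by blast
      then have "top_sim ?Q x y" using leQ[OF l] by (simp add: top_sim_def)
      then have "top_sim (quot_top T' T') x y" using sim[OF xX] by blast
      then have R: "?R'\<^sup>+\<^sup>+ x y" by (simp add: top_sim_def top_le_quot_top)
      let ?C = "{y. ?R'\<^sup>+\<^sup>+ x y}"
      have xC: "x \<in> ?C" using top_le_refl[of x T'] xX ts by blast
      have "subtopology T' ?C = subtopology T ?C"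
        using con[OF connectedin_comparability_component] xX ts by blast
      then have "top_le (subtopology T' ?C) x y \<longleftrightarrow> top_le (subtopology T ?C) x y" by simp
      then show "top_le T' x y" using xC R l by (simp add: top_le_subtopology)
    qed
    then show "top_le T' x y \<longleftrightarrow> top_le (block_top T Ys) x y"
      unfolding top_le_block_top[OF equalityD1[OF un] dj] by blast
  qed
  then show ?thesis using un ne bl' by (simp add: weak_set_compositions_def)
qed

section \<open>The internal coproduct\<close>

text \<open>The first block is incomparable with the others, so \<open>lamT_split\<close> takes off
  one factor at a time.\<close>

lemma lamT_block_top:
  assumes fin: "finite (topspace T)" and "\<Union>(set Ys) \<subseteq> topspace T" "sorted_wrt disjnt Ys"
  shows "lamT (block_top T Ys) =
    foldr (mult QSym_alg) (map (\<lambda>Y. lamT (subtopology T Y)) Ys) (unit QSym_alg)"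
  using assms(2,3)
proof (induction Ys)
  case Nil
  have "lamT (block_top T []) = M []" by (rule lamT_empty) simp
  then show ?case by (simp add: QSym_alg_def)
next
  case (Cons Y Ys)
  have sub: "Y \<subseteq> topspace T" "\<Union>(set Ys) \<subseteq> topspace T" and djYs: "sorted_wrt disjnt Ys"
    and "\<forall>A\<in>set Ys. disjnt Y A"
    using Cons.prems by auto
  then have djY: "Y \<inter> \<Union>(set Ys) = {}" by (auto simp: disjnt_def)
  note le = top_le_block_top[OF Cons.prems] and le' = top_le_block_top[OF sub(2) djYs]
  have finU: "finite Y" "finite (\<Union>(set Ys))" 
    by (rule finite_subset[OF sub(1) fin], rule finite_subset[OF sub(2) fin])
  let ?U = "block_top T (Y # Ys)"
  have ts: "topspace ?U = Y \<union> \<Union>(set Ys)" by simp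
  have inc: "\<not> top_le ?U x y \<and> \<not> top_le ?U y x" if "x \<in> Y" "y \<in> \<Union>(set Ys)" for x y
  proof -
    have "x \<notin> \<Union>(set Ys)" "y \<notin> Y" using that djY by auto
    then show ?thesis unfolding le by auto
  qed
  interpret split_space ?U Y "\<Union>(set Ys)"
    by unfold_locales (use finU ts djY inc in auto)
  have A: "subtopology ?U Y = subtopology T Y"
  proof (rule topology_eq_top_leI)
    show "finite (topspace (subtopology T Y))" using fin by simp
    show "topspace (subtopology ?U Y) = topspace (subtopology T Y)" using sub by auto
    show "top_le (subtopology ?U Y) x y \<longleftrightarrow> top_le (subtopology T Y) x y" for x y
      unfolding top_le_subtopology le by auto
  qed
  have B: "subtopology ?U (\<Union>(set Ys)) = block_top T Ys"
  proof (rule topology_eq_top_leI)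
    show "finite (topspace (block_top T Ys))" using finU by simp
    show "topspace (subtopology ?U (\<Union>(set Ys))) = topspace (block_top T Ys)" by auto
    show "top_le (subtopology ?U (\<Union>(set Ys))) x y \<longleftrightarrow> top_le (block_top T Ys) x y" for x y
      unfolding top_le_subtopology le le' using djY by auto
  qed
  show ?case unfolding lamT_split A B Cons.IH[OF sub(2) djYs] by simp
qed

text \<open>Distributivity: an element of \<open>listset\<close> chooses one summand in each
  factor.\<close>

lemma foldr_mult_sum:
  assumes "\<And>Y. Y \<in> set Ys \<Longrightarrow> finite (L Y)"
  shows "foldr (mult QSym_alg) (map (\<lambda>Y. \<Sum>B\<in>L Y. m B) Ys) e =
    (\<Sum>Bs\<in>listset (map L Ys). foldr (mult QSym_alg) (map m Bs) e)"
  using assms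
proof (induction Ys)
  case (Cons Y Ys)
  have "foldr (mult QSym_alg) (map (\<lambda>Y. \<Sum>B\<in>L Y. m B) (Y # Ys)) e
      = mult QSym_alg (\<Sum>B\<in>L Y. m B) (\<Sum>Bs\<in>listset (map L Ys). foldr (mult QSym_alg) (map m Bs) e)"
    using Cons by simp
  also have "\<dots> = (\<Sum>B\<in>L Y. \<Sum>Bs\<in>listset (map L Ys). mult QSym_alg (m B) (foldr (mult QSym_alg) (map m Bs) e))"
    unfolding mult_QSym_sum_left by (simp only: mult_QSym_sum_right)
  also have "\<dots> = (\<Sum>(B, Bs)\<in>L Y \<times> listset (map L Ys). foldr (mult QSym_alg) (map m (B # Bs)) e)"
    by (simp add: sum.cartesian_product)
  also have "\<dots> = (\<Sum>Bs\<in>listset (map L (Y # Ys)). foldr (mult QSym_alg) (map m Bs) e)"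
    by (rule sum.reindex_bij_witness[of _ "\<lambda>Bs. (hd Bs, tl Bs)" "\<lambda>(B, Bs). B # Bs"])
       (auto simp: set_Cons_def)
  finally show ?case .
qed simp

section \<open>Cutting and concatenating lists of blocks\<close>

lemma sorted_wrt_concat:
  "sorted_wrt P (concat Bs) \<longleftrightarrow>
     (\<forall>B\<in>set Bs. sorted_wrt P B) \<and> sorted_wrt (\<lambda>B C. \<forall>x\<in>set B. \<forall>y\<in>set C. P x y) Bs"
  by (induction Bs) (auto simp: sorted_wrt_append)

text \<open>\<open>below\<close> between two unions is \<open>below\<close> between all their
  members, so sortedness of the long list is sortedness inside the pieces together with sortedness
  of their unions. Flatness is a condition on the small blocks only, so the unions are merely weakly
  increasing.\<close>

lemma concat_in_lin_set_compositions:
  "[] \<notin> set Bs \<and> concat Bs \<in> lin_set_compositions T \<longleftrightarrow>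
     map (\<lambda>B. \<Union>(set B)) Bs \<in> weak_set_compositions T \<and>
     (\<forall>B\<in>set Bs. B \<in> lin_set_compositions (subtopology T (\<Union>(set B))))" (is "?L \<longleftrightarrow> ?R")
proof -
  have un: "\<Union>(set (map (\<lambda>B. \<Union>(set B)) Bs)) = \<Union>(set (concat Bs))" by auto
  have bl: "below T (\<Union>(set B)) (\<Union>(set C)) \<longleftrightarrow> (\<forall>A\<in>set B. \<forall>A'\<in>set C. below T A A')" for B C
    by (auto simp: below_def)
  have R: "?R \<longleftrightarrow> \<Union>(set (concat Bs)) = topspace T \<and> {} \<notin> set (map (\<lambda>B. \<Union>(set B)) Bs) \<and>
      sorted_wrt (\<lambda>B C. \<forall>x\<in>set B. \<forall>y\<in>set C. below T x y) Bs \<and>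
      (\<forall>B\<in>set Bs. {} \<notin> set B \<and> sorted_wrt (below T) B \<and> (\<forall>A\<in>set B. flat T A))"
  proof (cases "\<Union>(set (concat Bs)) = topspace T")
    case True
    then have sub: "\<Union>(set B) \<subseteq> topspace T" if "B \<in> set Bs" for B using that by auto
    have "B \<in> lin_set_compositions (subtopology T (\<Union>(set B))) \<longleftrightarrow>
        {} \<notin> set B \<and> sorted_wrt (below T) B \<and> (\<forall>A\<in>set B. flat T A)" if "B \<in> set Bs" for B
      using lin_set_compositions_subtopology_iff[OF sub[OF that], of B] by simp
    then have "(\<forall>B\<in>set Bs. B \<in> lin_set_compositions (subtopology T (\<Union>(set B)))) \<longleftrightarrow>
        (\<forall>B\<in>set Bs. {} \<notin> set B \<and> sorted_wrt (below T) B \<and> (\<forall>A\<in>set B. flat T A))"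
      by (rule ball_cong[OF refl])
    then show ?thesis
      unfolding weak_set_compositions_def mem_Collect_eq un sorted_wrt_map bl by argo
  next
    case False
    then show ?thesis unfolding weak_set_compositions_def mem_Collect_eq un by blast
  qed
  have ne: "{} \<notin> set (map (\<lambda>B. \<Union>(set B)) Bs) \<longleftrightarrow> [] \<notin> set Bs" if "\<forall>B\<in>set Bs. {} \<notin> set B"
  proof -
    have "\<Union>(set B) = {} \<longleftrightarrow> B = []" if "B \<in> set Bs" for B
      using \<open>\<forall>B\<in>set Bs. {} \<notin> set B\<close> that by (cases B) auto
    then show ?thesis by auto
  qed
  have "?L \<longleftrightarrow> \<Union>(set (concat Bs)) = topspace T \<and> [] \<notin> set Bs \<and>
      sorted_wrt (\<lambda>B C. \<forall>x\<in>set B. \<forall>y\<in>set C. below T x y) Bs \<and>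
      (\<forall>B\<in>set Bs. {} \<notin> set B \<and> sorted_wrt (below T) B \<and> (\<forall>A\<in>set B. flat T A))"
    unfolding lin_set_compositions_iff sorted_wrt_concat set_concat by blast
  then show ?thesis unfolding R using ne by blast
qed

text \<open>Excluding empty pieces bounds their number by the length of the list.\<close>

lemma finite_concat_eq: "finite {Bs. concat Bs = xs \<and> [] \<notin> set Bs}"
proof (rule finite_subset)
  let ?A = "{B. set B \<subseteq> set xs \<and> length B \<le> length xs}"
  show "{Bs. concat Bs = xs \<and> [] \<notin> set Bs} \<subseteq> {Bs. set Bs \<subseteq> ?A \<and> length Bs \<le> length xs}"
  proof safe
    fix Bs :: "'a list list" and B assume B: "B \<in> set Bs"
    show "x \<in> set B \<Longrightarrow> x \<in> set (concat Bs)" for x using B by auto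
    show "length B \<le> length (concat Bs)"
      using B by (simp add: length_concat member_le_sum_list)
  next
    fix Bs :: "'a list list" assume "[] \<notin> set Bs"
    then show "length Bs \<le> length (concat Bs)"
    proof (induction Bs)
      case (Cons B Bs)
      then obtain b B' where "B = b # B'" by (cases B) auto
      with Cons show ?case by simp
    qed simp
  qed
  have "finite ?A" by (rule finite_lists_length_le) simp
  then show "finite {Bs. set Bs \<subseteq> ?A \<and> length Bs \<le> length xs}" by (rule finite_lists_length_le)
qed

lemma concat_eq_mapD:
  "concat bs = map g xs \<Longrightarrow> \<exists>Bs. concat Bs = xs \<and> map (map g) Bs = bs"
proof (induction bs arbitrary: xs)
  case (Cons b bs)
  then have "b @ concat bs = map g xs" by simp
  then obtain us vs where xs: "xs = us @ vs" and b: "b = map g us" and bs: "concat bs = map g vs"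
    by (auto simp: append_eq_map_conv)
  obtain Bs where "concat Bs = vs" "map (map g) Bs = bs" using Cons.IH[OF bs] by blast
  then have "concat (us # Bs) = xs \<and> map (map g) (us # Bs) = b # bs" using xs b by simp
  then show ?case by (rule exI)
qed simp

lemma concat_length_inj:
  "concat Bs = concat Cs \<Longrightarrow> map length Bs = map length Cs \<Longrightarrow> Bs = Cs"
proof (induction Bs arbitrary: Cs)
  case (Cons B Bs)
  then obtain C Cs' where Cs: "Cs = C # Cs'" "length B = length C" by (cases Cs) auto
  with Cons.prems have "B = C" "concat Bs = concat Cs'" by auto
  with Cons Cs show ?case by simp
qed simp

text \<open>A cut is determined by the lengths of its pieces, so \<open>g\<close> may well identify
  entries. With \<open>g = card\<close>, cuts of a composition become cuts of the set composition
  behind it.\<close>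

lemma bij_betw_map_map_concat:
  "bij_betw (map (map g)) {Bs. concat Bs = xs \<and> [] \<notin> set Bs} {bs. concat bs = map g xs \<and> [] \<notin> set bs}"
  unfolding bij_betw_def
proof
  show "inj_on (map (map g)) {Bs. concat Bs = xs \<and> [] \<notin> set Bs}"
  proof (rule inj_onI)
    fix Bs Cs assume B: "Bs \<in> {Bs. concat Bs = xs \<and> [] \<notin> set Bs}" and C: "Cs \<in> {Bs. concat Bs = xs \<and> [] \<notin> set Bs}"
      and eq: "map (map g) Bs = map (map g) Cs"
    have "map length Bs = map length (map (map g) Bs)" by simp
    also have "\<dots> = map length Cs" unfolding eq by simp
    finally show "Bs = Cs" using B C by (intro concat_length_inj) simp_all
  qed
  show "map (map g) ` {Bs. concat Bs = xs \<and> [] \<notin> set Bs} = {bs. concat bs = map g xs \<and> [] \<notin> set bs}"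
  proof
    show "map (map g) ` {Bs. concat Bs = xs \<and> [] \<notin> set Bs} \<subseteq> {bs. concat bs = map g xs \<and> [] \<notin> set bs}"
      by (auto simp: map_concat)
    show "{bs. concat bs = map g xs \<and> [] \<notin> set bs} \<subseteq> map (map g) ` {Bs. concat Bs = xs \<and> [] \<notin> set Bs}"
    proof
      fix bs assume bs: "bs \<in> {bs. concat bs = map g xs \<and> [] \<notin> set bs}"
      then obtain Bs where Bs: "concat Bs = xs" "map (map g) Bs = bs" using concat_eq_mapD by blast
      have "[] \<notin> set Bs"
      proof
        assume "[] \<in> set Bs"
        then have "map g [] \<in> set (map (map g) Bs)" by (metis image_eqI list.set_map)
        then show False using Bs bs by simp
      qed
      then show "bs \<in> map (map g) ` {Bs. concat Bs = xs \<and> [] \<notin> set Bs}" using Bs by blast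
    qed
  qed
qed

lemma finite_weak_set_compositions:
  assumes "finite (topspace T)"
  shows "finite (weak_set_compositions T)"
proof (rule finite_subset)
  show "finite {Ys. set Ys \<subseteq> Pow (topspace T) \<and> distinct Ys}"
    by (rule finite_subset_distinct) (simp add: assms)
  show "weak_set_compositions T \<subseteq> {Ys. set Ys \<subseteq> Pow (topspace T) \<and> distinct Ys}"
  proof
    fix Ys assume Ys: "Ys \<in> weak_set_compositions T"
    have un: "\<Union>(set Ys) = topspace T" and ne: "{} \<notin> set Ys" and bl: "sorted_wrt (below T) Ys"
      using Ys by (auto simp: weak_set_compositions_def)
    have dj: "sorted_wrt disjnt Ys" by (rule sorted_wrt_below_disjnt[OF equalityD1[OF un] bl])
    have "Ys ! i \<noteq> Ys ! j" if "i < length Ys" "j < length Ys" "i \<noteq> j" for i j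
    proof
      assume eq: "Ys ! i = Ys ! j"
      have "disjnt (Ys ! i) (Ys ! j)" using dj[unfolded sorted_wrt_disjnt_iff] that by blast
      then have "Ys ! i = {}" using eq by (simp add: disjnt_def)
      then show False using ne nth_mem[OF that(1)] by simp
    qed
    then have "distinct Ys" by (simp add: distinct_conv_nth)
    moreover have "set Ys \<subseteq> Pow (topspace T)" using un by blast
    ultimately show "Ys \<in> {Ys. set Ys \<subseteq> Pow (topspace T) \<and> distinct Ys}" by simp
  qed
qed

lemma finite_admissible:
  assumes "finite (topspace T)"
  shows "finite {T'. admissible T T'}"
proof (rule finite_imageD)
  show "inj_on (\<lambda>T'. {U. openin T' U}) {T'. admissible T T'}"
    by (auto intro!: inj_onI simp: topology_eq)
  have "{U. openin T' U} \<subseteq> Pow (topspace T)" if "admissible T T'" for T'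
    using that openin_subset[of T'] by (auto simp: admissible_def finer_top_def)
  then have "(\<lambda>T'. {U. openin T' U}) ` {T'. admissible T T'} \<subseteq> Pow (Pow (topspace T))" by blast
  then show "finite ((\<lambda>T'. {U. openin T' U}) ` {T'. admissible T T'})"
    by (rule finite_subset) (simp add: assms)
qed

text \<open>The common summand of both sides. The second factor has sums of sizes, as in
  \<open>rho\<close>; for disjoint blocks these are the sizes of the unions.\<close>

definition block_term :: "'a set list list \<Rightarrow> (composition \<times> composition \<Rightarrow>\<^sub>0 'k::field)" where
  "block_term Bs = tensor (foldr (mult QSym_alg) (map (\<lambda>B. M (map card B)) Bs) (unit QSym_alg))
     (M (map (\<lambda>B. sum_list (map card B)) Bs))"

definition block_compositions :: "'a topology \<Rightarrow> 'a set list list set" where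
  "block_compositions T = {Bs. [] \<notin> set Bs \<and> concat Bs \<in> lin_set_compositions T}"

lemma finite_block_compositions:
  assumes "finite (topspace T)"
  shows "finite (block_compositions T)"
proof (rule finite_subset)
  show "block_compositions T \<subseteq> (\<Union>Xs\<in>lin_set_compositions T. {Bs. concat Bs = Xs \<and> [] \<notin> set Bs})"
    by (auto simp: block_compositions_def)
  show "finite (\<Union>Xs\<in>lin_set_compositions T. {Bs. concat Bs = Xs \<and> [] \<notin> set Bs})"
    using finite_lin_set_compositions[OF assms] finite_concat_eq by blast
qed

lemma rho_lamT:
  fixes T :: "'a topology"
  assumes fin: "finite (topspace T)"
  shows "rho (lamT T) = (\<Sum>Bs\<in>block_compositions T. block_term Bs :: _ \<Rightarrow>\<^sub>0 'k::field)"
proof -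
  have "rho (lamT T) = (\<Sum>Xs\<in>lin_set_compositions T. rho (M (map card Xs)) :: _ \<Rightarrow>\<^sub>0 'k)"
    unfolding lamT_def by (rule lin_sum) (simp add: rho_def lin_lin_ext)
  also have "\<dots> = (\<Sum>Xs\<in>lin_set_compositions T. \<Sum>Bs | Bs \<in> block_compositions T \<and> concat Bs = Xs. block_term Bs)"
  proof (rule sum.cong[OF refl])
    fix Xs assume Xs: "Xs \<in> lin_set_compositions T"
    let ?t = "\<lambda>bs. tensor (foldr (mult QSym_alg) (map M bs) (unit QSym_alg)) (M (map sum_list bs)) :: _ \<Rightarrow>\<^sub>0 'k"
    have "rho (M (map card Xs)) = (qsym_internal_coprod (map card Xs) :: _ \<Rightarrow>\<^sub>0 'k)"
      using card_lin_set_composition_pos[OF fin Xs]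
      by (simp add: rho_def M_def Abs_composition_inverse)
    also have "\<dots> = (\<Sum>bs | concat bs = map card Xs \<and> [] \<notin> set bs. ?t bs)"
      by (simp add: qsym_internal_coprod_def)
    also have "\<dots> = (\<Sum>Bs | concat Bs = Xs \<and> [] \<notin> set Bs. ?t (map (map card) Bs))"
      by (rule sum.reindex_bij_betw[OF bij_betw_map_map_concat, symmetric])
    also have "\<dots> = (\<Sum>Bs | concat Bs = Xs \<and> [] \<notin> set Bs. block_term Bs)"
      by (simp add: block_term_def comp_def)
    also have "{Bs. concat Bs = Xs \<and> [] \<notin> set Bs} = {Bs. Bs \<in> block_compositions T \<and> concat Bs = Xs}"
      using Xs by (auto simp: block_compositions_def)
    finally show "rho (M (map card Xs)) = (\<Sum>Bs | Bs \<in> block_compositions T \<and> concat Bs = Xs. block_term Bs :: _ \<Rightarrow>\<^sub>0 'k)" .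
  qed
  also have "\<dots> = (\<Sum>Bs\<in>block_compositions T. block_term Bs)"
    by (rule sum.group[OF finite_block_compositions[OF fin] finite_lin_set_compositions[OF fin]])
       (auto simp: block_compositions_def)
  finally show ?thesis .
qed

lemma listset_iff: "Bs \<in> listset As \<longleftrightarrow> list_all2 (\<in>) Bs As"
  by (induction As arbitrary: Bs) (auto simp: set_Cons_def list_all2_Cons2)

text \<open>Over a fixed weakly increasing set composition, the blocks are refined independently of
  each other, which gives a product of sets matching the product of factors in
  \<open>lamT_block_top\<close>.\<close>

lemma block_compositions_fiber:
  assumes Ys: "Ys \<in> weak_set_compositions T"
  shows "{Bs. Bs \<in> block_compositions T \<and> map (\<lambda>B. \<Union>(set B)) Bs = Ys} =
    listset (map (\<lambda>Y. lin_set_compositions (subtopology T Y)) Ys)"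
proof -
  have sub: "Y \<subseteq> topspace T" if "Y \<in> set Ys" for Y
    using Ys that by (auto simp: weak_set_compositions_def)
  have un: "\<Union>(set B) = Y" if "Y \<in> set Ys" "B \<in> lin_set_compositions (subtopology T Y)" for Y B
    using that lin_set_compositions_subtopology_iff[OF sub[OF that(1)]] by blast
  have iff: "Bs \<in> listset (map (\<lambda>Y. lin_set_compositions (subtopology T Y)) Ys) \<longleftrightarrow>
      map (\<lambda>B. \<Union>(set B)) Bs = Ys \<and> (\<forall>B\<in>set Bs. B \<in> lin_set_compositions (subtopology T (\<Union>(set B))))" for Bs
    using un
  proof (unfold listset_iff, induction Ys arbitrary: Bs)
    case (Cons Y Ys)
    show ?case
    proof (cases Bs)
      case (Cons B Bs')
      have "B \<in> lin_set_compositions (subtopology T Y) \<longleftrightarrow>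
          \<Union>(set B) = Y \<and> B \<in> lin_set_compositions (subtopology T (\<Union>(set B)))"
        using Cons.prems[of Y B] by auto
      moreover have "list_all2 (\<in>) Bs' (map (\<lambda>Y. lin_set_compositions (subtopology T Y)) Ys) \<longleftrightarrow>
        map (\<lambda>B. \<Union>(set B)) Bs' = Ys \<and> (\<forall>B\<in>set Bs'. B \<in> lin_set_compositions (subtopology T (\<Union>(set B))))"
        by (rule Cons.IH) (use Cons.prems in auto)
      ultimately show ?thesis unfolding Cons by auto
    qed simp
  qed auto
  show ?thesis
  proof (rule set_eqI)
    fix Bs
    show "Bs \<in> {Bs. Bs \<in> block_compositions T \<and> map (\<lambda>B. \<Union>(set B)) Bs = Ys} \<longleftrightarrow>
      Bs \<in> listset (map (\<lambda>Y. lin_set_compositions (subtopology T Y)) Ys)"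
      unfolding iff mem_Collect_eq block_compositions_def concat_in_lin_set_compositions using Ys by blast
  qed
qed

lemma lamT_internal_coprod:
  fixes T :: "'a topology"
  assumes fin: "finite (topspace T)"
  shows "(\<Sum>T' | admissible T T'. tensor (lamT T') (lamT (quot_top T T')))
    = (\<Sum>Bs\<in>block_compositions T. block_term Bs :: _ \<Rightarrow>\<^sub>0 'k::field)"
proof -
  let ?Q = "\<lambda>T'. lin_set_compositions (quot_top T T')"
  let ?L = "\<lambda>Y. lin_set_compositions (subtopology T Y)"
  have "(\<Sum>T' | admissible T T'. tensor (lamT T') (lamT (quot_top T T')) :: _ \<Rightarrow>\<^sub>0 'k)
      = (\<Sum>T' | admissible T T'. \<Sum>Ys\<in>?Q T'. tensor (lamT T') (M (map card Ys)))"
    by (simp only: lamT_def[of "quot_top T _"] tensor_sum_right)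
  also have "\<dots> = (\<Sum>(T', Ys)\<in>Sigma {T'. admissible T T'} ?Q. tensor (lamT T') (M (map card Ys)))"
    by (rule sum.Sigma[OF finite_admissible[OF fin]]) (simp add: finite_lin_set_compositions fin)
  \<comment> \<open>The set composition determines the admissible topology, so forgetting the
    topology is a bijection.\<close>
  also have "\<dots> = (\<Sum>Ys\<in>weak_set_compositions T. tensor (lamT (block_top T Ys)) (M (map card Ys)))"
    by (rule sum.reindex_bij_witness[of _ "\<lambda>Ys. (block_top T Ys, Ys)" snd])
       (use admissible_weak_set_composition[OF fin] weak_set_composition_admissible[OF fin] in auto)
  also have "\<dots> = (\<Sum>Ys\<in>weak_set_compositions T.
      \<Sum>Bs | Bs \<in> block_compositions T \<and> map (\<lambda>B. \<Union>(set B)) Bs = Ys. block_term Bs)"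
  proof (rule sum.cong[OF refl])
    fix Ys assume Ys: "Ys \<in> weak_set_compositions T"
    have un: "\<Union>(set Ys) = topspace T" and bl: "sorted_wrt (below T) Ys"
      using Ys by (auto simp: weak_set_compositions_def)
    have dj: "sorted_wrt disjnt Ys" by (rule sorted_wrt_below_disjnt[OF equalityD1[OF un] bl])
    have finL: "finite (?L Y)" for Y by (rule finite_lin_set_compositions) (simp add: fin)
    have "lamT (block_top T Ys)
        = foldr (mult QSym_alg) (map (\<lambda>Y. \<Sum>B\<in>?L Y. M (map card B)) Ys) (unit QSym_alg :: _ \<Rightarrow>\<^sub>0 'k)"
      using lamT_block_top[OF fin equalityD1[OF un] dj] by (simp only: lamT_def)
    also have "\<dots> = (\<Sum>Bs\<in>listset (map ?L Ys). foldr (mult QSym_alg) (map (\<lambda>B. M (map card B)) Bs) (unit QSym_alg))"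
      by (rule foldr_mult_sum[OF finL])
    finally have "tensor (lamT (block_top T Ys)) (M (map card Ys)) = (\<Sum>Bs\<in>listset (map ?L Ys).
        tensor (foldr (mult QSym_alg) (map (\<lambda>B. M (map card B)) Bs) (unit QSym_alg)) (M (map card Ys)) :: _ \<Rightarrow>\<^sub>0 'k)"
      by (simp only: tensor_sum_left)
    also have "\<dots> = (\<Sum>Bs\<in>listset (map ?L Ys). block_term Bs)"
    proof (rule sum.cong[OF refl])
      fix Bs assume "Bs \<in> listset (map ?L Ys)"
      then have Bs: "Bs \<in> block_compositions T" "map (\<lambda>B. \<Union>(set B)) Bs = Ys"
        using block_compositions_fiber[OF Ys] by auto
      have "card (\<Union>(set B)) = sum_list (map card B)" if B: "B \<in> set Bs" for B
      proof -
        have sub: "\<Union>(set B) \<subseteq> topspace T" using un Bs(2) B by auto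
        have "B \<in> lin_set_compositions (subtopology T (\<Union>(set B)))"
          using Bs(1) B unfolding block_compositions_def mem_Collect_eq concat_in_lin_set_compositions by blast
        then have "sorted_wrt (below T) B" "{} \<notin> set B"
          unfolding lin_set_compositions_subtopology_iff[OF sub] by auto
        then have dB: "sorted_wrt disjnt B" using sorted_wrt_below_disjnt[OF sub] by blast
        show ?thesis using dB sub
        proof (induction B)
          case (Cons A B)
          have "finite A" "finite (\<Union>(set B))" using Cons.prems fin by (auto intro: finite_subset)
          moreover have "A \<inter> \<Union>(set B) = {}" using Cons.prems by (auto simp: disjnt_def)
          ultimately have "card (A \<union> \<Union>(set B)) = card A + card (\<Union>(set B))" by (rule card_Un_disjoint)
          then show ?case using Cons by simp
        qed simp
      qed
      then have "map card Ys = map (\<lambda>B. sum_list (map card B)) Bs" using Bs(2) by auto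
      then show "tensor (foldr (mult QSym_alg) (map (\<lambda>B. M (map card B)) Bs) (unit QSym_alg)) (M (map card Ys))
          = (block_term Bs :: _ \<Rightarrow>\<^sub>0 'k)" by (simp add: block_term_def)
    qed
    finally show "tensor (lamT (block_top T Ys)) (M (map card Ys))
        = (\<Sum>Bs | Bs \<in> block_compositions T \<and> map (\<lambda>B. \<Union>(set B)) Bs = Ys. block_term Bs :: _ \<Rightarrow>\<^sub>0 'k)"
      unfolding block_compositions_fiber[OF Ys] .
  qed
  \<comment> \<open>The index set of \<open>rho_lamT\<close> again, fibered here over the unions of
    the pieces.\<close>
  also have "\<dots> = (\<Sum>Bs\<in>block_compositions T. block_term Bs)"
    by (rule sum.group[OF finite_block_compositions[OF fin] finite_weak_set_compositions[OF fin]])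
       (use concat_in_lin_set_compositions in \<open>auto simp: block_compositions_def\<close>)
  finally show ?thesis .
qed

lemma lam_rho:
  assumes Z: "infinite Z"
  shows "tensor_map (lam Z) (lam Z) (Gamma_H x) = rho (lam Z x)"
proof (rule lin_eqI[of "\<lambda>x. tensor_map (lam Z) (lam Z) (Gamma_H x)" "\<lambda>x. rho (lam Z x)"])
  show "lin (\<lambda>x. tensor_map (lam Z) (lam Z) (Gamma_H x))"
    by (rule lin_comp[OF lin_tensor_map]) (simp add: Gamma_H_def lin_lin_ext)
  show "lin (\<lambda>x. rho (lam Z x))" by (rule lin_comp[OF _ lin_lam]) (simp add: rho_def lin_lin_ext)
  fix C
  let ?T = "rep_ftop_class C"
  have fin: "finite (topspace ?T)" by (rule finite_rep_ftop_class)
  have "tensor_map (lam Z) (lam Z) (Gamma_H (bas C))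
      = (\<Sum>T' | admissible ?T T'. tensor (lam Z (bas (homeo_class T'))) (lam Z (bas (homeo_class (quot_top ?T T')))))"
    by (simp only: Gamma_H_def lin_ext_bas top_internal_coprod_def lin_sum[OF lin_tensor_map]
        tensor_map_tensor[OF lin_lam lin_lam])
  also have "\<dots> = (\<Sum>T' | admissible ?T T'. tensor (lamT T') (lamT (quot_top ?T T')))"
  proof (rule sum.cong[OF refl])
    fix T' assume "T' \<in> {T'. admissible ?T T'}"
    then have "finite (topspace T')" "finite (topspace (quot_top ?T T'))"
      using fin by (simp_all add: admissible_def finer_top_def)
    then show "tensor (lam Z (bas (homeo_class T'))) (lam Z (bas (homeo_class (quot_top ?T T'))))
        = tensor (lamT T') (lamT (quot_top ?T T'))" by (simp only: lam_homeo_class[OF Z])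
  qed
  also have "\<dots> = rho (lam Z (bas C))"
    by (simp only: lamT_internal_coprod[OF fin] rho_lamT[OF fin] lam_bas[OF Z])
  finally show "tensor_map (lam Z) (lam Z) (Gamma_H (bas C)) = rho (lam Z (bas C))" .
qed

theorem theorem5p6:
  fixes Z :: "'z::linorder set"
    and L :: "(ftop_class \<Rightarrow>\<^sub>0 'k::field) \<Rightarrow> (composition \<Rightarrow>\<^sub>0 'k)"
  assumes "infinite Z" and "countable Z"
    and "L = lam Z"
  shows "(\<forall>T :: 'a topology. finite (topspace T) \<longrightarrow>
            realize Z (L (bas (homeo_class T))) = top_series Z T \<and>
            L (bas (homeo_class T)) = (\<Sum>Xs\<in>lin_set_compositions T. M (map card Xs))) \<and>
         hopf_algebra_morphism H_alg QSym_alg L \<and>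
         tensor_map L L \<circ> Gamma_H = rho \<circ> L"
proof (intro conjI allI impI)
  fix T :: "'a topology"
  assume fin: "finite (topspace T)"
  have L: "L (bas (homeo_class T)) = lamT T"
    by (simp add: assms(3) lam_homeo_class[OF assms(1) fin])
  show "realize Z (L (bas (homeo_class T))) = top_series Z T"
    unfolding L by (rule realize_lamT[OF fin])
  show "L (bas (homeo_class T)) = (\<Sum>Xs\<in>lin_set_compositions T. M (map card Xs))"
    unfolding L by (rule lamT_def)
next
  show "hopf_algebra_morphism H_alg QSym_alg L"
    unfolding assms(3) by (rule lam_hopf_morphism[OF assms(1)])
  show "tensor_map L L \<circ> Gamma_H = rho \<circ> L"
    unfolding assms(3) comp_def lam_rho[OF assms(1)] ..
qed

end
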